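(* Let $X$ be a nonempty $\kappa$-additive $\mathrm{SC}_\kappa$-space. If $X$ is ($\kappa$-)perfect, then there is a superclosed $C\subseteq X$ which is homeomorphic to ${}^{\kappa}2$.
   Context: Work in ZFC; $\kappa$ is an uncountable regular cardinal with $2^{<\kappa}=\kappa$ (equivalently $\kappa^{<\kappa}=\kappa$). "Space" means regular Hausdorff topological space. ${}^{\kappa}\kappa$ is the set of all functions $\kappa\to\kappa$ with the bounded topology, generated by the sets $\{x\in{}^{\kappa}\kappa \mid s\subseteq x\}$, $s\in{}^{<\kappa}\kappa$ (sequences with values in $\kappa$ and length less than $\kappa$); the generalized Cantor space ${}^{\kappa}2\subseteq{}^{\kappa}\kappa$, the set of all functions $\kappa\to 2$, has the relative topology. A space is $\kappa$-additive if its topology is closed under intersections of fewer than $\kappa$ open sets. A space is perfect if it has no isolated points, i.e. no singleton is open; it is $\kappa$-perfect if no singleton is an intersection of fewer than $\kappa$ open sets. For $\kappa$-additive spaces the two notions coincide, and "($\kappa$-)perfect" means either of them. Superclosed sets: a tree is a set $T\subseteq{}^{<\kappa}\kappa$ closed under initial segments, and $[T]=\{x\in{}^{\kappa}\kappa\mid \forall\alpha<\kappa\ (x\restriction\alpha\in T)\}$. $T$ is pruned if every $s\in T$ has extensions in $T$ of every length $\alpha$ with $\operatorname{lh}(s)\le\alpha<\kappa$, where $\operatorname{lh}(s)$ is the length of $s$; it is ${<}\kappa$-closed if for every limit $\gamma<\kappa$ and $s\in{}^{\gamma}\kappa$, if $s\restriction\alpha\in T$ for all $\alpha<\gamma$ then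 $s\in T$; it is superclosed if it is pruned and ${<}\kappa$-closed. A closed $C\subseteq{}^{\kappa}\kappa$ is superclosed if $C=[T]$ for some superclosed tree $T$. The word "superclosed" is defined only for subsets of ${}^{\kappa}\kappa$; the $\kappa$-additive $\mathrm{SC}_\kappa$-spaces are, up to homeomorphism, exactly the superclosed subsets of ${}^{\kappa}\kappa$, and in "superclosed $C\subseteq X$" the space $X$ is regarded as such a subset. Strong $\kappa$-Choquet game $\mathrm{G}^s_\kappa(X)$: players I and II play $\kappa$-many rounds. In round $\alpha<\kappa$, I plays $(U_\alpha,x_\alpha)$ with $U_\alpha$ a relatively open subset of $\bigcap_{\beta<\alpha}V_\beta$ (which is $X$ if $\alpha=0$) and $x_\alpha\in U_\alpha$; then II plays a relatively open subset $V_\alpha$ of $\bigcap_{\beta<\alpha}V_\beta$ with $x_\alpha\in V_\alpha\subseteq U_\alpha$. II wins iff $\bigcap_{\alpha<\gamma}V_\alpha\ne\emptyset$ for every limit $\gamma\le\kappa$ (I wins as soon as such an intersection is empty). $X$ is an $\mathrm{SC}_\kappa$-space if it has weight $\le\kappa$ and II has a winning strategy in $\mathrm{G}^s_\kappa(X)$. *)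

theory Defs
  imports "HOL-Analysis.Analysis"
begin

unbundle cardinal_syntax

text \<open>
  The cardinal \<open>\<kappa>\<close> is represented by a type \<open>'k\<close> of class \<open>wellorder\<close> whose order is an
  initial ordinal: the elements of \<open>'k\<close> are the ordinals below \<open>\<kappa>\<close>, \<open>{..<\<alpha>}\<close> is the
  ordinal \<open>\<alpha>\<close>, and \<open>'k \<Rightarrow> 'k\<close> is the set of all functions from \<open>\<kappa>\<close> to \<open>\<kappa>\<close>.
\<close>

definition kappa :: "'k::wellorder rel" where
  "kappa = {(\<alpha>, \<beta>). \<alpha> \<le> \<beta>}"

definition zero_ord :: "'k::wellorder" where
  "zero_ord = (LEAST \<alpha>. True)"

definition one_ord :: "'k::wellorder" where
  "one_ord = (LEAST \<alpha>. zero_ord < \<alpha>)"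

definition limit_ord :: "'k::wellorder \<Rightarrow> bool" where
  "limit_ord \<gamma> \<longleftrightarrow> \<gamma> \<noteq> zero_ord \<and> (\<forall>\<alpha><\<gamma>. \<exists>\<beta>. \<alpha> < \<beta> \<and> \<beta> < \<gamma>)"

text \<open>
  A sequence of length \<open>\<alpha>\<close> is a partial function with domain \<open>{..<\<alpha>}\<close>; the extension relation
  is \<open>\<subseteq>\<^sub>m\<close>, and the restriction of \<open>s\<close> to \<open>\<alpha>\<close> is \<open>s |` {..<\<alpha>}\<close>.
\<close>

definition seqs_below :: "'k::wellorder set \<Rightarrow> ('k \<rightharpoonup> 'k) set" where
  "seqs_below A = {s. (\<exists>\<alpha>. dom s = {..<\<alpha>}) \<and> ran s \<subseteq> A}"

definition initial_seg :: "('k::wellorder \<Rightarrow> 'k) \<Rightarrow> 'k \<Rightarrow> ('k \<rightharpoonup> 'k)" where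
  "initial_seg x \<alpha> = (Some \<circ> x) |` {..<\<alpha>}"

text \<open>The last conjunct is \<open>2\<^sup><\<^sup>\<kappa> = \<kappa>\<close>, with \<open>2\<^sup><\<^sup>\<kappa>\<close> the number of binary sequences of length less than \<open>\<kappa>\<close>.\<close>

definition kappa_hyp :: "'k::wellorder itself \<Rightarrow> bool" where
  "kappa_hyp (_ :: 'k itself) \<longleftrightarrow>
     card_order (kappa :: 'k rel) \<and> natLeq <o (kappa :: 'k rel) \<and> regularCard (kappa :: 'k rel) \<and>
     |seqs_below {zero_ord, one_ord :: 'k}| =o (kappa :: 'k rel)"

definition bounded_topology :: "('k::wellorder \<Rightarrow> 'k) topology" where
  "bounded_topology =
     topology_generated_by {{x. s \<subseteq>\<^sub>m Some \<circ> x} | s. s \<in> seqs_below UNIV}"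

definition cantor_space :: "('k::wellorder \<Rightarrow> 'k) topology" where
  "cantor_space = subtopology bounded_topology {x. range x \<subseteq> {zero_ord, one_ord}}"

definition tree :: "('k::wellorder \<rightharpoonup> 'k) set \<Rightarrow> bool" where
  "tree T \<longleftrightarrow> T \<subseteq> seqs_below UNIV \<and> (\<forall>s\<in>T. \<forall>\<alpha>. s |` {..<\<alpha>} \<in> T)"

definition branches :: "('k::wellorder \<rightharpoonup> 'k) set \<Rightarrow> ('k \<Rightarrow> 'k) set" where
  "branches T = {x. \<forall>\<alpha>. initial_seg x \<alpha> \<in> T}"

definition pruned :: "('k::wellorder \<rightharpoonup> 'k) set \<Rightarrow> bool" where
  "pruned T \<longleftrightarrow>
     (\<forall>s\<in>T. \<forall>\<delta> \<alpha>. dom s = {..<\<delta>} \<and> \<delta> \<le> \<alpha> \<longrightarrow> (\<exists>t\<in>T. dom t = {..<\<alpha>} \<and> s \<subseteq>\<^sub>m t))"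

definition lt_kappa_closed :: "('k::wellorder \<rightharpoonup> 'k) set \<Rightarrow> bool" where
  "lt_kappa_closed T \<longleftrightarrow>
     (\<forall>\<gamma> s. limit_ord \<gamma> \<and> dom s = {..<\<gamma>} \<and> (\<forall>\<alpha><\<gamma>. s |` {..<\<alpha>} \<in> T) \<longrightarrow> s \<in> T)"

definition superclosed_tree :: "('k::wellorder \<rightharpoonup> 'k) set \<Rightarrow> bool" where
  "superclosed_tree T \<longleftrightarrow> tree T \<and> pruned T \<and> lt_kappa_closed T"

definition superclosed :: "('k::wellorder \<Rightarrow> 'k) set \<Rightarrow> bool" where
  "superclosed C \<longleftrightarrow>
     closedin bounded_topology C \<and> (\<exists>T. superclosed_tree T \<and> C = branches T)"

definition kappa_additive :: "'k::wellorder itself \<Rightarrow> 'a topology \<Rightarrow> bool" where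
  "kappa_additive (_ :: 'k itself) X \<longleftrightarrow>
     (\<forall>\<U>. (\<forall>U\<in>\<U>. openin X U) \<and> |\<U>| <o (kappa :: 'k rel) \<longrightarrow> openin X (topspace X \<inter> \<Inter>\<U>))"

definition perfect_space :: "'a topology \<Rightarrow> bool" where
  "perfect_space X \<longleftrightarrow> (\<forall>x\<in>topspace X. \<not> openin X {x})"

definition kappa_perfect_space :: "'k::wellorder itself \<Rightarrow> 'a topology \<Rightarrow> bool" where
  "kappa_perfect_space (_ :: 'k itself) X \<longleftrightarrow>
     (\<forall>x\<in>topspace X. \<not> (\<exists>\<U>. (\<forall>U\<in>\<U>. openin X U) \<and> |\<U>| <o (kappa :: 'k rel) \<and>
        {x} = topspace X \<inter> \<Inter>\<U>))"

definition weight_le_kappa :: "'k::wellorder itself \<Rightarrow> 'a topology \<Rightarrow> bool" where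
  "weight_le_kappa (_ :: 'k itself) X \<longleftrightarrow>
     (\<exists>\<B>. |\<B>| \<le>o (kappa :: 'k rel) \<and> (\<forall>V\<in>\<B>. openin X V) \<and>
        (\<forall>U x. openin X U \<and> x \<in> U \<longrightarrow> (\<exists>V\<in>\<B>. x \<in> V \<and> V \<subseteq> U)))"

text \<open>
  The strong \<open>\<kappa>\<close>-Choquet game. A move of player I is a pair \<open>(U, x)\<close>, a move of player II is a
  set \<open>V\<close>. A strategy for II takes the moves of I in the rounds \<open>\<beta> \<le> \<alpha>\<close> and the moves of II
  in the rounds \<open>\<beta> < \<alpha>\<close> (both as partial functions on rounds) and returns II's move in
  round \<open>\<alpha>\<close>. Runs are total functions on rounds of which only an initial part may be constrained,
  so that runs cut short by an empty intersection are covered.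
\<close>

type_synonym ('k, 'a) strategy = "('k \<rightharpoonup> 'a set \<times> 'a) \<Rightarrow> ('k \<rightharpoonup> 'a set) \<Rightarrow> 'a set"

definition inter_before :: "'a topology \<Rightarrow> ('k::wellorder \<Rightarrow> 'a set) \<Rightarrow> 'k \<Rightarrow> 'a set" where
  "inter_before X V \<alpha> = topspace X \<inter> (\<Inter>\<beta>\<in>{..<\<alpha>}. V \<beta>)"

definition legal_I ::
    "'a topology \<Rightarrow> ('k::wellorder \<Rightarrow> 'a set) \<Rightarrow> 'k \<Rightarrow> 'a set \<times> 'a \<Rightarrow> bool" where
  "legal_I X V \<alpha> m \<longleftrightarrow>
     openin (subtopology X (inter_before X V \<alpha>)) (fst m) \<and> snd m \<in> fst m"

definition legal_II ::
    "'a topology \<Rightarrow> ('k::wellorder \<Rightarrow> 'a set) \<Rightarrow> 'k \<Rightarrow> 'a set \<times> 'a \<Rightarrow> 'a set \<Rightarrow> bool" where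
  "legal_II X V \<alpha> m W \<longleftrightarrow>
     openin (subtopology X (inter_before X V \<alpha>)) W \<and> snd m \<in> W \<and> W \<subseteq> fst m"

definition response ::
    "('k::wellorder, 'a) strategy \<Rightarrow> ('k \<Rightarrow> 'a set \<times> 'a) \<Rightarrow> ('k \<Rightarrow> 'a set) \<Rightarrow> 'k \<Rightarrow> 'a set" where
  "response \<sigma> M V \<alpha> = \<sigma> ((Some \<circ> M) |` {..\<alpha>}) ((Some \<circ> V) |` {..<\<alpha>})"

definition good_round ::
    "'a topology \<Rightarrow> ('k::wellorder, 'a) strategy \<Rightarrow> ('k \<Rightarrow> 'a set \<times> 'a) \<Rightarrow> ('k \<Rightarrow> 'a set) \<Rightarrow> 'k \<Rightarrow> bool"
  where
  "good_round X \<sigma> M V \<alpha> \<longleftrightarrow> legal_I X V \<alpha> (M \<alpha>) \<and> V \<alpha> = response \<sigma> M V \<alpha>"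

text \<open>
  A winning strategy answers legally as long as I plays legally, and keeps the intersections
  nonempty at all limits \<open>\<gamma> < \<kappa>\<close> (second conjunct) and at \<open>\<gamma> = \<kappa>\<close> (third conjunct).
\<close>

definition winning_II :: "'a topology \<Rightarrow> ('k::wellorder, 'a) strategy \<Rightarrow> bool" where
  "winning_II X \<sigma> \<longleftrightarrow> (\<forall>M V.
     (\<forall>\<alpha>. (\<forall>\<beta><\<alpha>. good_round X \<sigma> M V \<beta>) \<and> legal_I X V \<alpha> (M \<alpha>)
          \<longrightarrow> legal_II X V \<alpha> (M \<alpha>) (response \<sigma> M V \<alpha>)) \<and>
     (\<forall>\<gamma>. limit_ord \<gamma> \<and> (\<forall>\<beta><\<gamma>. good_round X \<sigma> M V \<beta>) \<longrightarrow> inter_before X V \<gamma> \<noteq> {}) \<and>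
     ((\<forall>\<beta>. good_round X \<sigma> M V \<beta>) \<longrightarrow> topspace X \<inter> (\<Inter>\<beta>. V \<beta>) \<noteq> {}))"

definition SC_space :: "'k::wellorder itself \<Rightarrow> 'a topology \<Rightarrow> bool" where
  "SC_space K X \<longleftrightarrow>
     weight_le_kappa K X \<and> (\<exists>\<sigma> :: ('k, 'a) strategy. winning_II X \<sigma>)"

text \<open>The map \<open>f\<close> identifies \<open>X\<close> with a superclosed subset of \<open>\<^sup>\<kappa>\<kappa>\<close>.\<close>

definition superclosed_presentation :: "'a topology \<Rightarrow> ('a \<Rightarrow> 'k::wellorder \<Rightarrow> 'k) \<Rightarrow> bool" where
  "superclosed_presentation X f \<longleftrightarrow>
     superclosed (f ` topspace X) \<and>
     homeomorphic_map X (subtopology bounded_topology (f ` topspace X)) f"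

end

theory Submission
  imports Defs
begin

text \<open>
  Two constructions carry the proof. The first turns a winning strategy of player II into a
  presentation of \<open>X\<close> as a superclosed set; the second thins a tree so that its branches form a copy
  of the generalized Cantor space.

  Presentation. Since \<open>\<kappa>\<close> is uncountable, \<open>\<kappa>\<close>-additivity and regularity give \<open>X\<close> a base of \<open>\<kappa>\<close> many
  clopen sets \<open>B i\<close> (\<open>clopen_base\<close>). One builds a tree of cells: at level \<open>\<alpha>\<close> the space is partitioned
  into open cells, and each cell carries a run of the game of length \<open>\<alpha>\<close> in which the moves of I
  are the larger cells and all the moves of II contain the given cell. To split a cell \<open>W\<close>,
  let I play \<open>(W, x)\<close> for the various \<open>x \<in> W\<close>. The replies of II cover \<open>W\<close>, so \<open>W\<close> is covered by
  basic sets whose trace on \<open>W\<close> lies in one reply, and sending each point to the least basic set of this kind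
  makes the cover disjoint; \<open>\<kappa>\<close>-additivity keeps the pieces open. Replies and cells interleave,
  so the winning condition says exactly that a descending sequence of cells, of limit length
  or of length \<open>\<kappa>\<close>, has nonempty intersection (\<open>code_realized\<close>). Nonempty intersections at limits
  below \<open>\<kappa>\<close> make the tree \<open><\<kappa>\<close>-closed, those at \<open>\<kappa>\<close> make every branch the code of a point. If moreover
  the pieces at level \<open>\<alpha>\<close> are chosen to decide \<open>B \<alpha>\<close>, the cells form a base, and coding points by
  branches is a homeomorphism (\<open>superclosed_presentation_code\<close>).

  Cantor subset. Let \<open>X\<close> be presented as the branches of a superclosed tree \<open>T\<close>. Keeping at every
  node only the two least successors yields a tree that is again superclosed, because the condition is
  local (\<open>superclosed_binary_part\<close>). As \<open>X\<close> has no isolated point, every branch passes through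
  splitting nodes of \<open>T\<close> at unboundedly many levels; by regularity of \<open>\<kappa>\<close> their set has order
  type \<open>\<kappa>\<close>. Listing the turns that a branch takes at its splitting nodes is therefore a map into
  \<open>\<^sup>\<kappa>2\<close>, and it is a homeomorphism (\<open>binary_part_homeomorphic_cantor_space\<close>): a branch below level \<open>\<alpha>\<close>
  and its turns before the order type of its splitting levels below \<open>\<alpha>\<close> determine each other.
\<close>


section \<open>Ordinals below \<open>\<kappa>\<close>\<close>

lemma Field_kappa: "Field (kappa :: 'k::wellorder rel) = UNIV"
  unfolding kappa_def Field_def by auto

lemma zero_ord_le: "zero_ord \<le> (\<alpha> :: 'k::wellorder)"
  unfolding zero_ord_def by (simp add: Least_le)

context
  assumes hyp: "kappa_hyp TYPE('k::wellorder)"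
begin

lemma Card_order_kappa: "Card_order (kappa :: 'k rel)"
  using hyp Field_kappa unfolding kappa_hyp_def by metis

lemma infinite_UNIV_kappa: "infinite (UNIV :: 'k set)"
proof -
  have "natLeq \<le>o (kappa :: 'k rel)"
    using hyp unfolding kappa_hyp_def by (simp add: ordLess_imp_ordLeq)
  then have "Cinfinite (kappa :: 'k rel)"
    using cinfinite_mono natLeq_cinfinite Card_order_kappa by blast
  then show ?thesis unfolding cinfinite_def Field_kappa by simp
qed

lemma card_of_UNIV_kappa: "|UNIV :: 'k set| =o (kappa :: 'k rel)"
  using card_of_Field_ordIso[OF Card_order_kappa] unfolding Field_kappa .

lemma card_lessThan: "|{..<\<alpha> :: 'k}| <o (kappa :: 'k rel)"
proof -
  have "underS kappa \<alpha> = {..<\<alpha>}" unfolding underS_def kappa_def by auto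
  then show ?thesis using card_of_underS[OF Card_order_kappa, of \<alpha>] Field_kappa by auto
qed

lemma card_countable: "countable A \<Longrightarrow> |A| <o (kappa :: 'k rel)"
proof -
  assume "countable A"
  then obtain f :: "_ \<Rightarrow> nat" where "inj_on f A" unfolding countable_def by blast
  then have "|A| \<le>o |UNIV :: nat set|" using card_of_ordLeqI[of f A UNIV] by simp
  then have "|A| \<le>o natLeq" using card_of_nat ordLeq_ordIso_trans by blast
  then show ?thesis using hyp unfolding kappa_hyp_def by (meson ordLeq_ordLess_trans)
qed

lemma ex_greater: "\<exists>\<beta>. (\<alpha> :: 'k) < \<beta>"
proof -
  have "\<exists>\<beta>\<in>UNIV. \<alpha> \<noteq> \<beta> \<and> (\<alpha>, \<beta>) \<in> (kappa :: 'k rel)"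
    using infinite_Card_order_limit[OF Card_order_kappa, of \<alpha>] infinite_UNIV_kappa
    unfolding Field_kappa by blast
  then show ?thesis unfolding kappa_def by (auto simp: less_le)
qed

text \<open>
  This is regularity of \<open>\<kappa>\<close>. A set that is not cofinal has only a non-strict bound, and the strict
  one exists because \<open>\<kappa>\<close> has no largest element.
\<close>

lemma card_less_bounded:
  assumes "|A :: 'k set| <o (kappa :: 'k rel)"
  shows "\<exists>\<rho>. \<forall>a\<in>A. a < \<rho>"
proof -
  have "\<not> |A| =o (kappa :: 'k rel)" using assms not_ordLess_ordIso by blast
  then have "\<not> cofinal A kappa"
    using hyp unfolding kappa_hyp_def regularCard_def Field_kappa by blast
  then obtain a :: 'k where "\<forall>b\<in>A. b \<le> a"
    unfolding cofinal_def kappa_def by force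
  then show ?thesis using ex_greater[of a] by (meson order_le_less_trans)
qed

lemma zero_less_one_ord: "(zero_ord :: 'k) < one_ord"
  unfolding one_ord_def using ex_greater LeastI_ex by metis

end

lemma ordinal_cases:
  fixes \<alpha> :: "'k::wellorder"
  obtains "\<alpha> = zero_ord" | \<beta> where "{..<\<alpha>} = {..\<beta>}" | "limit_ord \<alpha>"
proof (cases "\<exists>\<beta><\<alpha>. \<forall>\<gamma>. \<not> (\<beta> < \<gamma> \<and> \<gamma> < \<alpha>)")
  case True
  then obtain \<beta> where "\<beta> < \<alpha>" "\<forall>\<gamma>. \<not> (\<beta> < \<gamma> \<and> \<gamma> < \<alpha>)" by blast
  then have "{..<\<alpha>} = {..\<beta>}" by (auto simp: not_less intro: le_less_trans)
  then show ?thesis using that by blast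
next
  case False
  then show ?thesis using that unfolding limit_ord_def by blast
qed

lemma ex_successor:
  assumes hyp: "kappa_hyp TYPE('k::wellorder)"
  shows "\<exists>\<alpha>'. {..<\<alpha>'} = {..\<alpha> :: 'k}"
proof -
  define \<alpha>' where "\<alpha>' = (LEAST \<beta>. \<alpha> < \<beta>)"
  have "\<alpha> < \<alpha>'" unfolding \<alpha>'_def using LeastI_ex[OF ex_greater[OF hyp]] .
  moreover have "\<beta> \<le> \<alpha>" if "\<beta> < \<alpha>'" for \<beta>
    using not_less_Least[OF that[unfolded \<alpha>'_def]] by simp
  ultimately have "{..<\<alpha>'} = {..\<alpha>}" by (intro set_eqI) (meson atMost_iff lessThan_iff le_less_trans)
  then show ?thesis by blast
qed

section \<open>The bounded topology\<close>

text \<open>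
  A node \<open>s\<close> of length \<open>\<alpha>\<close> is handled below through the total functions \<open>x\<close> that extend it, that is, as
  \<open>initial_seg x \<alpha>\<close>; \<open>agree x y \<alpha>\<close> says that \<open>x\<close> and \<open>y\<close> represent the same node. Notions that depend on a
  node only become functions of \<open>x\<close> and \<open>\<alpha>\<close> together with a congruence rule for \<open>agree\<close>.
\<close>

definition agree :: "('k::wellorder \<Rightarrow> 'b) \<Rightarrow> ('k \<Rightarrow> 'b) \<Rightarrow> 'k \<Rightarrow> bool" where
  "agree x y \<alpha> \<longleftrightarrow> (\<forall>\<beta><\<alpha>. x \<beta> = y \<beta>)"

lemma agree_sym: "agree x y \<alpha> \<Longrightarrow> agree y x \<alpha>"
  and agree_trans: "agree x y \<alpha> \<Longrightarrow> agree y z \<alpha> \<Longrightarrow> agree x z \<alpha>"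
  and agree_mono: "agree x y \<alpha> \<Longrightarrow> \<beta> \<le> \<alpha> \<Longrightarrow> agree x y \<beta>"
  and agree_refl [simp]: "agree x x \<alpha>"
  by (auto simp: agree_def)

lemma first_difference:
  assumes "\<not> agree x y \<delta>"
  obtains \<epsilon> where "\<epsilon> < (\<delta> :: 'k::wellorder)" "agree x y \<epsilon>" "x \<epsilon> \<noteq> y \<epsilon>"
proof -
  define \<epsilon> where "\<epsilon> = (LEAST \<epsilon>. \<epsilon> < \<delta> \<and> x \<epsilon> \<noteq> y \<epsilon>)"
  have "\<exists>\<epsilon>. \<epsilon> < \<delta> \<and> x \<epsilon> \<noteq> y \<epsilon>" using assms unfolding agree_def by blast
  from LeastI_ex[OF this] have e: "\<epsilon> < \<delta>" "x \<epsilon> \<noteq> y \<epsilon>" unfolding \<epsilon>_def by blast+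
  have "agree x y \<epsilon>" unfolding agree_def
    using not_less_Least[of _ "\<lambda>\<epsilon>. \<epsilon> < \<delta> \<and> x \<epsilon> \<noteq> y \<epsilon>", folded \<epsilon>_def] e(1) less_trans by blast
  then show thesis using that e by blast
qed

lemma agree_all_imp_eq:
  assumes "kappa_hyp TYPE('k::wellorder)" and "\<And>\<alpha> :: 'k. agree x y \<alpha>"
  shows "x = y"
  using ex_greater[OF assms(1)] assms(2) unfolding agree_def by blast

lemma initial_seg_eq_iff: "initial_seg x \<alpha> = initial_seg y \<alpha> \<longleftrightarrow> agree x y \<alpha>"
  unfolding initial_seg_def agree_def restrict_map_def fun_eq_iff by auto

lemma dom_initial_seg [simp]: "dom (initial_seg x \<alpha>) = {..<\<alpha>}"
  unfolding initial_seg_def by auto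

lemma initial_seg_restrict: "\<beta> \<le> \<alpha> \<Longrightarrow> initial_seg x \<alpha> |` {..<\<beta>} = initial_seg x \<beta>"
  unfolding initial_seg_def restrict_map_def by (auto simp: fun_eq_iff)

lemma initial_seg_the:
  assumes "dom s = {..<\<alpha>}" "\<beta> \<le> \<alpha>"
  shows "initial_seg (the \<circ> s) \<beta> = s |` {..<\<beta>}"
proof
  fix \<gamma>
  have "\<gamma> < \<beta> \<Longrightarrow> \<gamma> \<in> dom s" using assms by auto
  then show "initial_seg (the \<circ> s) \<beta> \<gamma> = (s |` {..<\<beta>}) \<gamma>"
    unfolding initial_seg_def restrict_map_def by auto
qed

lemma initial_seg_eq_length: "initial_seg x \<alpha> = initial_seg y \<beta> \<Longrightarrow> \<alpha> = \<beta>"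
proof -
  assume "initial_seg x \<alpha> = initial_seg y \<beta>"
  then have "{..<\<alpha>} = {..<\<beta>}" using dom_initial_seg by metis
  then have "\<not> \<alpha> < \<beta>" "\<not> \<beta> < \<alpha>" by (metis lessThan_iff less_irrefl)+
  then show "\<alpha> = \<beta>" by simp
qed

lemma restrict_map_id: "dom s \<subseteq> A \<Longrightarrow> s |` A = s"
  by (rule ext) (metis domIff restrict_in restrict_out subsetD)

lemma initial_seg_the_self: "dom s = {..<\<alpha>} \<Longrightarrow> initial_seg (the \<circ> s) \<alpha> = s"
  using initial_seg_the[of s \<alpha> \<alpha>] restrict_map_id[of s "{..<\<alpha>}"] by simp

lemma initial_seg_apply: "\<beta> < \<alpha> \<Longrightarrow> initial_seg x \<alpha> \<beta> = Some (x \<beta>)"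
  unfolding initial_seg_def by simp

lemma initial_seg_subset_iff: "initial_seg x \<alpha> \<subseteq>\<^sub>m Some \<circ> y \<longleftrightarrow> agree x y \<alpha>"
  unfolding map_le_def dom_initial_seg agree_def Ball_def lessThan_iff
  by (simp add: initial_seg_apply cong: imp_cong)

lemma initial_seg_mem_seqs: "initial_seg x \<alpha> \<in> seqs_below UNIV"
  unfolding seqs_below_def by (intro CollectI conjI exI[of _ \<alpha>] dom_initial_seg subset_UNIV)

lemma initial_seg_succ:
  assumes "{..<\<alpha>} = {..\<beta>}"
  shows "initial_seg x \<alpha> = (initial_seg x \<beta>)(\<beta> \<mapsto> x \<beta>)"
proof
  fix \<gamma>
  have "\<gamma> < \<alpha> \<longleftrightarrow> \<gamma> = \<beta> \<or> \<gamma> < \<beta>"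
    unfolding lessThan_iff[symmetric] assms by (auto simp: le_less)
  then show "initial_seg x \<alpha> \<gamma> = ((initial_seg x \<beta>)(\<beta> \<mapsto> x \<beta>)) \<gamma>"
    unfolding initial_seg_def restrict_map_def by simp
qed

lemma openin_bounded_topology:
  "openin bounded_topology U \<longleftrightarrow>
     (\<forall>x\<in>U. \<exists>\<alpha>. \<forall>y. agree x y \<alpha> \<longrightarrow> y \<in> (U :: ('k::wellorder \<Rightarrow> 'k) set))"
proof
  assume "openin bounded_topology U"
  then have "generate_topology_on {{x. s \<subseteq>\<^sub>m Some \<circ> x} | s :: 'k \<rightharpoonup> 'k. s \<in> seqs_below UNIV} U"
    unfolding bounded_topology_def openin_topology_generated_by_iff .
  then show "\<forall>x\<in>U. \<exists>\<alpha>. \<forall>y. agree x y \<alpha> \<longrightarrow> y \<in> U"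
  proof induction
    case (Int a b)
    show ?case
    proof
      fix x assume "x \<in> a \<inter> b"
      then obtain \<alpha> \<beta> where "\<forall>y. agree x y \<alpha> \<longrightarrow> y \<in> a" "\<forall>y. agree x y \<beta> \<longrightarrow> y \<in> b"
        using Int.IH by blast
      then have "\<forall>y. agree x y (max \<alpha> \<beta>) \<longrightarrow> y \<in> a \<inter> b"
        using agree_mono by (metis IntI max.cobounded1 max.cobounded2)
      then show "\<exists>\<alpha>. \<forall>y. agree x y \<alpha> \<longrightarrow> y \<in> a \<inter> b" by blast
    qed
  next
    case (Basis a)
    then obtain s \<alpha> where s: "a = {x. s \<subseteq>\<^sub>m Some \<circ> x}" "dom s = {..<\<alpha>}"
      unfolding seqs_below_def by blast
    have "a = {x. agree (the \<circ> s) x \<alpha>}"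
      unfolding s(1) using initial_seg_subset_iff[of "the \<circ> s" \<alpha>] initial_seg_the_self[OF s(2)] by auto
    then show ?case using agree_trans by blast
  next
    case (UN K)
    show ?case
    proof
      fix x assume "x \<in> \<Union>K"
      then obtain k where "k \<in> K" "x \<in> k" by blast
      then show "\<exists>\<alpha>. \<forall>y. agree x y \<alpha> \<longrightarrow> y \<in> \<Union>K" using UN.IH by (meson UnionI)
    qed
  qed simp
next
  assume R: "\<forall>x\<in>U. \<exists>\<alpha>. \<forall>y. agree x y \<alpha> \<longrightarrow> y \<in> U"
  have basic: "openin bounded_topology {y. agree x y \<alpha>}" for x :: "'k \<Rightarrow> 'k" and \<alpha>
    unfolding bounded_topology_def
    by (rule topology_generated_by_Basis)
      (use initial_seg_mem_seqs[of x \<alpha>] in \<open>auto simp: initial_seg_subset_iff[symmetric]\<close>)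
  show "openin bounded_topology U"
    unfolding openin_subopen[of _ U]
  proof
    fix x assume "x \<in> U"
    then obtain \<alpha> where "\<forall>y. agree x y \<alpha> \<longrightarrow> y \<in> U" using R by blast
    then show "\<exists>V. openin bounded_topology V \<and> x \<in> V \<and> V \<subseteq> U"
      using basic[of x \<alpha>] by (intro exI[of _ "{y. agree x y \<alpha>}"]) auto
  qed
qed

lemma topspace_bounded_topology [simp]: "topspace bounded_topology = (UNIV :: ('k::wellorder \<Rightarrow> 'k) set)"
  using openin_subset[of bounded_topology UNIV] openin_bounded_topology[of "UNIV :: ('k \<Rightarrow> 'k) set"] by auto

lemma closedin_branches: "closedin bounded_topology (branches T)"
proof -
  have "openin bounded_topology (UNIV - branches T)"
    unfolding openin_bounded_topology
  proof
    fix x assume "x \<in> UNIV - branches T"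
    then obtain \<alpha> where "initial_seg x \<alpha> \<notin> T" unfolding branches_def by blast
    then have "\<forall>y. agree x y \<alpha> \<longrightarrow> y \<in> UNIV - branches T"
      unfolding branches_def by (simp add: initial_seg_eq_iff[symmetric]) metis
    then show "\<exists>\<alpha>. \<forall>y. agree x y \<alpha> \<longrightarrow> y \<in> UNIV - branches T" by blast
  qed
  then show ?thesis unfolding closedin_def by simp
qed

lemma superclosed_branches: "superclosed_tree T \<Longrightarrow> superclosed (branches T)"
  unfolding superclosed_def using closedin_branches by blast

lemma openin_subtopology_bounded:
  "openin (subtopology bounded_topology A) U \<longleftrightarrow>
     U \<subseteq> A \<and> (\<forall>x\<in>U. \<exists>\<alpha>. \<forall>y\<in>A. agree x y \<alpha> \<longrightarrow> y \<in> (U :: ('k::wellorder \<Rightarrow> 'k) set))" (is "?L \<longleftrightarrow> ?R")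
proof
  assume ?L
  then obtain V where V: "openin bounded_topology V" "U = V \<inter> A"
    unfolding openin_subtopology by blast
  then have "\<forall>x\<in>V. \<exists>\<alpha>. \<forall>y. agree x y \<alpha> \<longrightarrow> y \<in> V"
    by (simp add: openin_bounded_topology)
  then show ?R unfolding V(2) by blast
next
  assume R: ?R
  let ?V = "{y. \<exists>x\<in>U. \<exists>\<alpha>. agree x y \<alpha> \<and> (\<forall>z\<in>A. agree x z \<alpha> \<longrightarrow> z \<in> U)}"
  have "openin bounded_topology ?V"
    unfolding openin_bounded_topology
  proof
    fix y assume "y \<in> ?V"
    then obtain x \<alpha> where "x \<in> U" "agree x y \<alpha>" "\<forall>z\<in>A. agree x z \<alpha> \<longrightarrow> z \<in> U" by blast
    then have "\<forall>z. agree y z \<alpha> \<longrightarrow> z \<in> ?V" using agree_trans by blast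
    then show "\<exists>\<alpha>. \<forall>z. agree y z \<alpha> \<longrightarrow> z \<in> ?V" by blast
  qed
  moreover have "U = ?V \<inter> A"
  proof
    show "U \<subseteq> ?V \<inter> A"
    proof
      fix x assume x: "x \<in> U"
      then obtain \<alpha> where "\<forall>y\<in>A. agree x y \<alpha> \<longrightarrow> y \<in> U" using R by blast
      then have "x \<in> ?V" using x agree_refl[of x \<alpha>] by blast
      then show "x \<in> ?V \<inter> A" using x R by blast
    qed
  qed blast
  ultimately show ?L unfolding openin_subtopology by blast
qed

section \<open>Branches through nodes\<close>

lemma recursion_on_kappa:
  fixes G :: "('k::wellorder \<Rightarrow> 'b) \<Rightarrow> 'k \<Rightarrow> 'b"
  assumes "\<And>x y \<alpha>. agree x y \<alpha> \<Longrightarrow> G x \<alpha> = G y \<alpha>"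
  obtains x where "\<And>\<alpha>. x \<alpha> = G x \<alpha>"
proof -
  have "adm_wf {(\<alpha>, \<beta>). \<alpha> < \<beta>} G"
    unfolding adm_wf_def using assms by (auto simp: agree_def)
  then have "wfrec {(\<alpha>, \<beta>). \<alpha> < \<beta>} G = G (wfrec {(\<alpha>, \<beta>). \<alpha> < \<beta>} G)"
    by (rule wfrec_fixpoint[OF wf])
  then have "wfrec {(\<alpha>, \<beta>). \<alpha> < \<beta>} G \<alpha> = G (wfrec {(\<alpha>, \<beta>). \<alpha> < \<beta>} G) \<alpha>" for \<alpha>
    by (rule fun_cong)
  then show thesis by (rule that)
qed

definition children :: "('k::wellorder \<rightharpoonup> 'k) set \<Rightarrow> ('k \<Rightarrow> 'k) \<Rightarrow> 'k \<Rightarrow> 'k set" where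
  "children T x \<alpha> = {v. (initial_seg x \<alpha>)(\<alpha> \<mapsto> v) \<in> T}"

lemma children_cong: "agree x y \<alpha> \<Longrightarrow> children T x \<alpha> = children T y \<alpha>"
  unfolding children_def by (simp add: initial_seg_eq_iff[symmetric])

text \<open>
  Transfinite recursion along \<open>g\<close>: the choice function \<open>g\<close> takes care of successor steps, and
  \<open><\<kappa>\<close>-closure of limit steps. With \<open>\<delta>\<close> arbitrary it extends a given node to a branch, with \<open>\<delta> = 0\<close> it
  produces a branch all of whose values are prescribed by \<open>g\<close>.
\<close>

lemma branch_of_choice:
  fixes T :: "('k::wellorder \<rightharpoonup> 'k) set"
  assumes T: "tree T" "lt_kappa_closed T"
    and local: "\<And>x y \<alpha>. agree x y \<alpha> \<Longrightarrow> g x \<alpha> = g y \<alpha>"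
    and g: "\<And>x \<alpha>. initial_seg x \<alpha> \<in> T \<Longrightarrow> g x \<alpha> \<in> children T x \<alpha>"
    and z: "initial_seg z \<delta> \<in> T"
  obtains x where "x \<in> branches T" "agree z x \<delta>" "\<And>\<alpha>. \<delta> \<le> \<alpha> \<Longrightarrow> x \<alpha> = g x \<alpha>"
proof -
  define G where "G x \<alpha> = (if \<alpha> < \<delta> then z \<alpha> else g x \<alpha>)" for x \<alpha>
  have "\<And>x y \<alpha>. agree x y \<alpha> \<Longrightarrow> G x \<alpha> = G y \<alpha>" unfolding G_def using local by simp
  then obtain x where x: "\<And>\<alpha>. x \<alpha> = G x \<alpha>" using recursion_on_kappa[of G] by blast
  have zx: "agree z x \<delta>" unfolding agree_def using x by (simp add: G_def)
  have sub: "s |` {..<\<alpha>} \<in> T" if "s \<in> T" for s \<alpha> using T(1) that unfolding tree_def by blast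
  have xg: "x \<alpha> = g x \<alpha>" if "\<delta> \<le> \<alpha>" for \<alpha> using x[of \<alpha>] unfolding G_def if_not_P[OF leD[OF that]] .
  have "initial_seg x \<alpha> \<in> T" for \<alpha>
  proof (induction \<alpha> rule: less_induct)
    case (less \<alpha>)
    show ?case
    proof (cases "\<alpha> \<le> \<delta>")
      case True
      then have "initial_seg x \<alpha> = initial_seg z \<delta> |` {..<\<alpha>}"
        by (metis agree_mono agree_sym initial_seg_eq_iff initial_seg_restrict zx)
      then show ?thesis using sub z by simp
    next
      case False
      show ?thesis
      proof (cases \<alpha> rule: ordinal_cases)
        case 1
        then show ?thesis using False zero_ord_le[of \<delta>] by simp
      next
        case (2 \<beta>)
        have "\<beta> \<in> {..<\<alpha>}" unfolding 2 by simp
        moreover have "\<delta> \<in> {..\<beta>}" unfolding 2[symmetric] using False by simp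
        ultimately have "\<beta> < \<alpha>" "\<delta> \<le> \<beta>" by simp_all
        then have "x \<beta> \<in> children T x \<beta>" using g[OF less] xg[of \<beta>] by simp
        then show ?thesis unfolding initial_seg_succ[OF 2] children_def by (simp only: mem_Collect_eq)
      next
        case 3
        have "initial_seg x \<alpha> |` {..<\<beta>} \<in> T" if "\<beta> < \<alpha>" for \<beta>
          unfolding initial_seg_restrict[OF less_imp_le[OF that]] by (rule less[OF that])
        then show ?thesis using T(2) 3 dom_initial_seg unfolding lt_kappa_closed_def by blast
      qed
    qed
  qed
  then have "x \<in> branches T" unfolding branches_def by blast
  then show thesis using that zx xg by blast
qed

lemma branch_node: "x \<in> branches T \<Longrightarrow> initial_seg x \<alpha> \<in> T"
  unfolding branches_def by blast

lemma branch_child: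
  assumes "kappa_hyp TYPE('k::wellorder)" and "x \<in> branches T"
  shows "x (\<alpha> :: 'k) \<in> children T x \<alpha>"
proof -
  obtain \<alpha>' where \<alpha>': "{..<\<alpha>'} = {..\<alpha>}" using ex_successor[OF assms(1)] by blast
  show ?thesis
    using branch_node[OF assms(2), of \<alpha>'] unfolding initial_seg_succ[OF \<alpha>'] children_def by (simp only: mem_Collect_eq)
qed

lemma superclosed_children:
  assumes "kappa_hyp TYPE('k::wellorder)" and "superclosed_tree T" and "initial_seg x (\<alpha> :: 'k) \<in> T"
  shows "children T x \<alpha> \<noteq> {}"
proof -
  obtain \<alpha>' where \<alpha>': "{..<\<alpha>'} = {..\<alpha>}" using ex_successor[OF assms(1)] by blast
  have "\<alpha> \<in> {..<\<alpha>'}" unfolding \<alpha>' by simp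
  then have "\<alpha> \<le> \<alpha>'" by simp
  then obtain t where t: "t \<in> T" "dom t = {..<\<alpha>'}" "initial_seg x \<alpha> \<subseteq>\<^sub>m t"
    using assms(2)[unfolded superclosed_tree_def pruned_def, THEN conjunct2, THEN conjunct1,
        rule_format, OF assms(3), of \<alpha> \<alpha>'] dom_initial_seg by blast
  have "t \<beta> = Some (x \<beta>)" if "\<beta> < \<alpha>" for \<beta>
    using t(3) that initial_seg_apply[OF that, of x] unfolding map_le_def dom_initial_seg
    by (metis lessThan_iff)
  then have a: "agree (the \<circ> t) x \<alpha>" unfolding agree_def by simp
  have "t = (initial_seg (the \<circ> t) \<alpha>)(\<alpha> \<mapsto> (the \<circ> t) \<alpha>)"
    using initial_seg_the_self[OF t(2)] unfolding initial_seg_succ[OF \<alpha>'] by (rule sym)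
  then have "(the \<circ> t) \<alpha> \<in> children T (the \<circ> t) \<alpha>"
    using t(1) unfolding children_def mem_Collect_eq by (rule subst[where P = "\<lambda>s. s \<in> T"])
  then show ?thesis using children_cong[OF a] by blast
qed

text \<open>
  In a \<open><\<kappa>\<close>-closed tree, prunedness reduces to the existence of one-step extensions: these can be
  iterated to a branch, whose initial segments are the required extensions.
\<close>

lemma superclosed_treeI:
  fixes T :: "('k::wellorder \<rightharpoonup> 'k) set"
  assumes T: "tree T" "lt_kappa_closed T"
    and c: "\<And>x \<alpha>. initial_seg x \<alpha> \<in> T \<Longrightarrow> children T x \<alpha> \<noteq> {}"
  shows "superclosed_tree T"
proof -
  have "\<exists>t\<in>T. dom t = {..<\<alpha>} \<and> s \<subseteq>\<^sub>m t" if s: "s \<in> T" "dom s = {..<\<delta>}" "\<delta> \<le> \<alpha>" for s \<delta> \<alpha>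
  proof -
    define g where "g x \<alpha> = (SOME v. v \<in> children T x \<alpha>)" for x \<alpha>
    have "\<And>x y \<alpha>. agree x y \<alpha> \<Longrightarrow> g x \<alpha> = g y \<alpha>" unfolding g_def using children_cong by metis
    moreover have "\<And>x \<alpha>. initial_seg x \<alpha> \<in> T \<Longrightarrow> g x \<alpha> \<in> children T x \<alpha>"
      unfolding g_def using c by (simp add: some_in_eq)
    moreover have "initial_seg (the \<circ> s) \<delta> \<in> T" using initial_seg_the_self[OF s(2)] s(1) by simp
    ultimately obtain x where x: "x \<in> branches T" "agree (the \<circ> s) x \<delta>"
      using branch_of_choice[OF T] by blast
    have "s = initial_seg x \<delta>" using x(2) initial_seg_the_self[OF s(2)] initial_seg_eq_iff by metis
    moreover have "initial_seg x \<delta> \<beta> = initial_seg x \<alpha> \<beta>" if "\<beta> < \<delta>" for \<beta>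
      using that order.strict_trans2[OF that s(3)] by (simp add: initial_seg_apply)
    ultimately have "s \<subseteq>\<^sub>m initial_seg x \<alpha>" unfolding map_le_def by simp
    then show ?thesis using branch_node[OF x(1)] dom_initial_seg by blast
  qed
  then show ?thesis unfolding superclosed_tree_def pruned_def using T by blast
qed

section \<open>Thinning a tree to binary splitting\<close>

definition first_child :: "('k::wellorder \<rightharpoonup> 'k) set \<Rightarrow> ('k \<Rightarrow> 'k) \<Rightarrow> 'k \<Rightarrow> 'k" where
  "first_child T x \<alpha> = (LEAST v. v \<in> children T x \<alpha>)"

definition second_child :: "('k::wellorder \<rightharpoonup> 'k) set \<Rightarrow> ('k \<Rightarrow> 'k) \<Rightarrow> 'k \<Rightarrow> 'k" where
  "second_child T x \<alpha> = (LEAST v. v \<in> children T x \<alpha> \<and> v \<noteq> first_child T x \<alpha>)"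

definition splits :: "('k::wellorder \<rightharpoonup> 'k) set \<Rightarrow> ('k \<Rightarrow> 'k) \<Rightarrow> 'k set" where
  "splits T x = {\<alpha>. \<exists>v\<in>children T x \<alpha>. v \<noteq> first_child T x \<alpha>}"

text \<open>
  A value that is not the value of a child is excluded by membership in \<open>T\<close>; so it does no harm that
  \<open>second_child\<close> is an arbitrary value at nodes with a single child.
\<close>

definition binary_part :: "('k::wellorder \<rightharpoonup> 'k) set \<Rightarrow> ('k \<rightharpoonup> 'k) set" where
  "binary_part T = {initial_seg x \<alpha> | x \<alpha>. initial_seg x \<alpha> \<in> T \<and>
     (\<forall>\<beta><\<alpha>. x \<beta> \<in> {first_child T x \<beta>, second_child T x \<beta>})}"

lemma first_child_cong: "agree x y \<alpha> \<Longrightarrow> first_child T x \<alpha> = first_child T y \<alpha>"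
  and second_child_cong: "agree x y \<alpha> \<Longrightarrow> second_child T x \<alpha> = second_child T y \<alpha>"
  and splits_cong: "agree x y \<alpha> \<Longrightarrow> \<alpha> \<in> splits T x \<longleftrightarrow> \<alpha> \<in> splits T y"
  unfolding second_child_def first_child_def splits_def using children_cong[of x y \<alpha> T] by auto

lemma first_child_in: "children T x \<alpha> \<noteq> {} \<Longrightarrow> first_child T x \<alpha> \<in> children T x \<alpha>"
  unfolding first_child_def by (rule LeastI_ex) blast

lemma second_child_in:
  assumes "\<alpha> \<in> splits T x"
  shows "second_child T x \<alpha> \<in> children T x \<alpha>" and "second_child T x \<alpha> \<noteq> first_child T x \<alpha>"
proof -
  have "\<exists>v. v \<in> children T x \<alpha> \<and> v \<noteq> first_child T x \<alpha>" using assms unfolding splits_def by blast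
  from LeastI_ex[OF this] show "second_child T x \<alpha> \<in> children T x \<alpha>" "second_child T x \<alpha> \<noteq> first_child T x \<alpha>"
    unfolding second_child_def by blast+
qed

lemma mem_binary_part:
  "initial_seg x \<alpha> \<in> binary_part T \<longleftrightarrow>
     initial_seg x \<alpha> \<in> T \<and> (\<forall>\<beta><\<alpha>. x \<beta> \<in> {first_child T x \<beta>, second_child T x \<beta>})"
proof
  assume "initial_seg x \<alpha> \<in> binary_part T"
  then obtain y \<beta> where y: "initial_seg x \<alpha> = initial_seg y \<beta>" "initial_seg y \<beta> \<in> T"
    "\<forall>\<gamma><\<beta>. y \<gamma> \<in> {first_child T y \<gamma>, second_child T y \<gamma>}"
    unfolding binary_part_def by blast
  have e: "\<alpha> = \<beta>" using y(1) by (rule initial_seg_eq_length)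
  have a: "agree x y \<alpha>" using y(1) initial_seg_eq_iff unfolding e by blast
  have "x \<gamma> \<in> {first_child T x \<gamma>, second_child T x \<gamma>}" if "\<gamma> < \<alpha>" for \<gamma>
  proof -
    have "agree x y \<gamma>" using agree_mono[OF a] that by simp
    then show ?thesis
      using y(3) a that first_child_cong[of x y \<gamma> T] second_child_cong[of x y \<gamma> T] unfolding e agree_def by simp
  qed
  then show "initial_seg x \<alpha> \<in> T \<and> (\<forall>\<beta><\<alpha>. x \<beta> \<in> {first_child T x \<beta>, second_child T x \<beta>})"
    using y(1,2) by simp
qed (auto simp: binary_part_def)

lemma binary_branch_iff:
  fixes x :: "'k::wellorder \<Rightarrow> 'k"
  assumes "kappa_hyp TYPE('k)"
  shows "x \<in> branches (binary_part T) \<longleftrightarrow>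
     x \<in> branches T \<and> (\<forall>\<alpha>. x \<alpha> \<in> {first_child T x \<alpha>, second_child T x \<alpha>})"
  using ex_greater[OF assms] unfolding branches_def mem_Collect_eq mem_binary_part by blast

text \<open>
  The extended node is represented by the function \<open>x(\<alpha> := v)\<close> at the successor of \<open>\<alpha>\<close>.
\<close>

lemma children_binary_part:
  fixes x :: "'k::wellorder \<Rightarrow> 'k"
  assumes "kappa_hyp TYPE('k)" and x: "initial_seg x \<alpha> \<in> binary_part T"
    and v: "v \<in> children T x \<alpha>" "v \<in> {first_child T x \<alpha>, second_child T x \<alpha>}"
  shows "v \<in> children (binary_part T) x \<alpha>"
proof -
  obtain \<alpha>' where \<alpha>': "{..<\<alpha>'} = {..\<alpha>}" using ex_successor[OF assms(1)] by blast
  have lt: "\<beta> < \<alpha>' \<longleftrightarrow> \<beta> \<le> \<alpha>" for \<beta> unfolding lessThan_iff[symmetric] \<alpha>' by simp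
  define y where "y = x(\<alpha> := v)"
  have a: "agree x y \<beta>" if "\<beta> \<le> \<alpha>" for \<beta> using that unfolding agree_def y_def by auto
  have y: "initial_seg y \<alpha>' = (initial_seg x \<alpha>)(\<alpha> \<mapsto> v)"
    unfolding initial_seg_succ[OF \<alpha>'] using a[of \<alpha>] initial_seg_eq_iff[of x \<alpha> y] by (simp add: y_def)
  have "y \<beta> \<in> {first_child T y \<beta>, second_child T y \<beta>}" if "\<beta> < \<alpha>'" for \<beta>
  proof -
    have "\<beta> \<le> \<alpha>" using that lt by simp
    then have "x \<beta> \<in> {first_child T x \<beta>, second_child T x \<beta>}" if "\<beta> \<noteq> \<alpha>"
      using x that unfolding mem_binary_part by simp
    then show ?thesis
      using v(2) first_child_cong[OF a[OF \<open>\<beta> \<le> \<alpha>\<close>]] second_child_cong[OF a[OF \<open>\<beta> \<le> \<alpha>\<close>]]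
      by (cases "\<beta> = \<alpha>") (simp_all add: y_def)
  qed
  moreover have "initial_seg y \<alpha>' \<in> T"
    using v(1) unfolding y children_def mem_Collect_eq .
  ultimately have "initial_seg y \<alpha>' \<in> binary_part T" unfolding mem_binary_part by blast
  then show ?thesis unfolding y children_def by (simp only: mem_Collect_eq)
qed

text \<open>
  Membership in the binary part restricts one value at a time, so it is inherited by initial
  segments and passes to limits; and the least child always survives.
\<close>

lemma superclosed_binary_part:
  fixes T :: "('k::wellorder \<rightharpoonup> 'k) set"
  assumes hyp: "kappa_hyp TYPE('k)" and T: "superclosed_tree T"
  shows "superclosed_tree (binary_part T)"
proof (rule superclosed_treeI)
  have tree: "tree T" and closed: "lt_kappa_closed T" using T unfolding superclosed_tree_def by auto
  show "tree (binary_part T)"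
    unfolding tree_def
  proof (intro conjI ballI allI)
    show "binary_part T \<subseteq> seqs_below UNIV" using tree unfolding tree_def binary_part_def by blast
  next
    fix s :: "'k \<rightharpoonup> 'k" and \<beta> assume s: "s \<in> binary_part T"
    then obtain x \<alpha> where x: "s = initial_seg x \<alpha>" unfolding binary_part_def by blast
    show "s |` {..<\<beta>} \<in> binary_part T"
    proof (cases "\<beta> \<le> \<alpha>")
      case True
      have "initial_seg x \<beta> \<in> T"
        using tree s unfolding tree_def x mem_binary_part initial_seg_restrict[OF True, symmetric] by blast
      then show ?thesis
        using s order.strict_trans2[OF _ True] unfolding x initial_seg_restrict[OF True] mem_binary_part by blast
    next
      case False
      then have "dom s \<subseteq> {..<\<beta>}" unfolding x dom_initial_seg by auto
      then show ?thesis using s restrict_map_id by metis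
    qed
  qed
  show "lt_kappa_closed (binary_part T)"
    unfolding lt_kappa_closed_def
  proof (intro allI impI)
    fix \<gamma> and s :: "'k \<rightharpoonup> 'k"
    assume A: "limit_ord \<gamma> \<and> dom s = {..<\<gamma>} \<and> (\<forall>\<alpha><\<gamma>. s |` {..<\<alpha>} \<in> binary_part T)"
    then have lim: "limit_ord \<gamma>" and dom: "dom s = {..<\<gamma>}"
      and sub: "\<And>\<alpha>. \<alpha> < \<gamma> \<Longrightarrow> s |` {..<\<alpha>} \<in> binary_part T" by iprover+
    define x where "x = the \<circ> s"
    have s: "s = initial_seg x \<gamma>" unfolding x_def using initial_seg_the_self[OF dom] by (rule sym)
    have B: "initial_seg x \<alpha> \<in> binary_part T" if "\<alpha> < \<gamma>" for \<alpha>
      using sub[OF that] unfolding s initial_seg_restrict[OF less_imp_le[OF that]] .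
    have "s |` {..<\<alpha>} \<in> T" if "\<alpha> < \<gamma>" for \<alpha>
      using B[OF that] unfolding mem_binary_part s initial_seg_restrict[OF less_imp_le[OF that]] by blast
    then have "s \<in> T" using closed lim dom unfolding lt_kappa_closed_def by blast
    moreover have "x \<beta> \<in> {first_child T x \<beta>, second_child T x \<beta>}" if "\<beta> < \<gamma>" for \<beta>
    proof -
      obtain \<alpha> where "\<beta> < \<alpha>" "\<alpha> < \<gamma>" using lim \<open>\<beta> < \<gamma>\<close> unfolding limit_ord_def by blast
      then show ?thesis using B[of \<alpha>] unfolding mem_binary_part by blast
    qed
    ultimately show "s \<in> binary_part T" unfolding s mem_binary_part by blast
  qed
  fix x :: "'k \<Rightarrow> 'k" and \<alpha> assume x: "initial_seg x \<alpha> \<in> binary_part T"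
  then have "first_child T x \<alpha> \<in> children T x \<alpha>"
    using first_child_in superclosed_children[OF hyp T] unfolding mem_binary_part by blast
  then show "children (binary_part T) x \<alpha> \<noteq> {}" using children_binary_part[OF hyp x] by blast
qed

section \<open>Order types of bounded parts of a set of ordinals\<close>

text \<open>
  \<open>otp S \<alpha>\<close> is the order type of \<open>S \<inter> \<alpha>\<close>, written as the least strict upper bound of the order types at
  the earlier elements of \<open>S\<close>.
\<close>

function otp :: "'k::wellorder set \<Rightarrow> 'k \<Rightarrow> 'k" where
  "otp S \<alpha> = (LEAST \<rho>. \<forall>\<beta><\<alpha>. \<beta> \<in> S \<longrightarrow> otp S \<beta> < \<rho>)"
  by auto
termination
  by (relation "inv_image {(\<alpha>, \<beta>). \<alpha> < \<beta>} snd") (auto intro: wf)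

declare otp.simps [simp del]

lemma otp_cong: "(\<And>\<beta>. \<beta> < \<alpha> \<Longrightarrow> \<beta> \<in> S \<longleftrightarrow> \<beta> \<in> S') \<Longrightarrow> otp S \<alpha> = otp S' \<alpha>"
proof (induction \<alpha> rule: less_induct)
  case (less \<alpha>)
  have "(\<beta> < \<alpha> \<longrightarrow> \<beta> \<in> S \<longrightarrow> otp S \<beta> < \<rho>) = (\<beta> < \<alpha> \<longrightarrow> \<beta> \<in> S' \<longrightarrow> otp S' \<beta> < \<rho>)" for \<beta> \<rho>
    using less.IH[of \<beta>] less.prems order.strict_trans by metis
  then show ?case unfolding otp.simps[of _ \<alpha>] by presburger
qed

lemma otp_le: "(\<And>\<beta>. \<beta> < \<alpha> \<Longrightarrow> \<beta> \<in> S \<Longrightarrow> otp S \<beta> < \<rho>) \<Longrightarrow> otp S \<alpha> \<le> \<rho>"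
  unfolding otp.simps[of S \<alpha>] by (rule Least_le) blast

context
  assumes hyp: "kappa_hyp TYPE('k::wellorder)"
begin

lemma image_bounded: "\<exists>\<rho> :: 'k. \<forall>\<beta><\<alpha> :: 'k. f \<beta> < \<rho>"
proof -
  have "|f ` {..<\<alpha>}| <o (kappa :: 'k rel)"
    using card_of_image card_lessThan[OF hyp] ordLeq_ordLess_trans by blast
  from card_less_bounded[OF hyp this] show ?thesis by blast
qed

lemma otp_less:
  assumes "\<beta> < (\<alpha> :: 'k)" and "\<beta> \<in> S"
  shows "otp S \<beta> < otp S \<alpha>"
proof -
  have "\<exists>\<rho>. \<forall>\<beta><\<alpha>. \<beta> \<in> S \<longrightarrow> otp S \<beta> < \<rho>" using image_bounded[of \<alpha> "otp S"] by blast
  from LeastI_ex[OF this] show ?thesis using assms unfolding otp.simps[of S \<alpha>] by blast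
qed

lemma otp_inj:
  assumes "\<beta> \<in> S" "(\<alpha> :: 'k) \<in> S" "otp S \<beta> = otp S \<alpha>"
  shows "\<beta> = \<alpha>"
  using otp_less[of \<beta> \<alpha> S] otp_less[of \<alpha> \<beta> S] assms by (cases \<beta> \<alpha> rule: linorder_cases) auto

text \<open>
  An unbounded subset of \<open>\<kappa>\<close> has order type \<open>\<kappa>\<close>. The elements of \<open>S\<close> of rank below \<open>\<rho>\<close> are at most
  \<open>|\<rho>|\<close> many, hence bounded by regularity; the least element of \<open>S\<close> that is not among them has rank \<open>\<rho>\<close>.
\<close>

lemma otp_surj:
  assumes S: "\<And>\<alpha> :: 'k. \<exists>\<beta>\<in>S. \<alpha> \<le> \<beta>"
  obtains \<delta> where "\<delta> \<in> S" "otp S \<delta> = \<rho>"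
proof -
  \<comment> \<open>Rank is injective on \<open>S\<close>, so \<open>D\<close> embeds into \<open>\<rho>\<close>.\<close>
  define D where "D = {\<delta>\<in>S. otp S \<delta> < \<rho>}"
  have "inj_on (otp S) D" unfolding D_def inj_on_def using otp_inj by blast
  moreover have "otp S ` D \<subseteq> {..<\<rho>}" unfolding D_def by blast
  ultimately have "|D| \<le>o |{..<\<rho>}|" using card_of_ordLeq by blast
  then have "|D| <o (kappa :: 'k rel)" using card_lessThan[OF hyp] ordLeq_ordLess_trans by blast
  then obtain \<eta> where \<eta>: "\<forall>\<delta>\<in>D. \<delta> < \<eta>" using card_less_bounded[OF hyp] by blast
  obtain \<beta> where \<beta>: "\<beta> \<in> S" "\<eta> \<le> \<beta>" using S by blast
  then have ex: "\<exists>\<delta>. \<delta> \<in> S \<and> \<delta> \<notin> D" using \<eta> leD by blast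
  define \<delta> where "\<delta> = (LEAST \<delta>. \<delta> \<in> S \<and> \<delta> \<notin> D)"
  have \<delta>: "\<delta> \<in> S" "\<delta> \<notin> D" using LeastI_ex[OF ex] unfolding \<delta>_def by blast+
  have "otp S \<delta> \<le> \<rho>"
  proof (rule otp_le)
    fix \<beta> assume "\<beta> < \<delta>" "\<beta> \<in> S"
    then have "\<beta> \<in> D" using not_less_Least unfolding \<delta>_def by blast
    then show "otp S \<beta> < \<rho>" unfolding D_def by blast
  qed
  moreover have "\<not> otp S \<delta> < \<rho>" using \<delta> unfolding D_def by blast
  ultimately show thesis using that[OF \<delta>(1)] by simp
qed

end

section \<open>The binary part of a perfect superclosed tree is a Cantor space\<close>

text \<open>
  \<open>turns T x \<rho>\<close> records whether \<open>x\<close> takes the first or the second child at its \<open>\<rho>\<close>-th splitting node.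
  Splitting is measured in \<open>T\<close>; for nodes of the binary part it means the same in the binary part.
\<close>

definition turns :: "('k::wellorder \<rightharpoonup> 'k) set \<Rightarrow> ('k \<Rightarrow> 'k) \<Rightarrow> 'k \<Rightarrow> 'k" where
  "turns T x \<rho> =
     (let \<delta> = (THE \<delta>. \<delta> \<in> splits T x \<and> otp (splits T x) \<delta> = \<rho>)
      in if x \<delta> = first_child T x \<delta> then zero_ord else one_ord)"

lemma otp_splits_cong: "agree x y \<alpha> \<Longrightarrow> otp (splits T x) \<alpha> = otp (splits T y) \<alpha>"
  using otp_cong splits_cong agree_mono less_imp_le by metis

context
  fixes T :: "('k::wellorder \<rightharpoonup> 'k) set"
  assumes hyp: "kappa_hyp TYPE('k)" and T: "superclosed_tree T"
    and perfect: "\<And>x \<alpha>. x \<in> branches T \<Longrightarrow> \<exists>y\<in>branches T. agree x y \<alpha> \<and> y \<noteq> x"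
begin

lemma child_not_split:
  assumes "x \<in> branches T" "\<alpha> \<notin> splits T x"
  shows "x \<alpha> = first_child T x \<alpha>"
  using branch_child[OF hyp assms(1), of \<alpha>] assms(2) unfolding splits_def by blast

text \<open>
  Another branch agrees with \<open>x\<close> below \<open>\<alpha>\<close>; where it first leaves \<open>x\<close>, the tree splits.
\<close>

lemma splits_unbounded:
  assumes "x \<in> branches T"
  shows "\<exists>\<beta>\<in>splits T x. \<alpha> \<le> \<beta>"
proof -
  obtain y where y: "y \<in> branches T" "agree x y \<alpha>" "y \<noteq> x" using perfect[OF assms] by blast
  then obtain \<delta> where "\<not> agree x y \<delta>" using agree_all_imp_eq[OF hyp] by blast
  then obtain \<epsilon> where \<epsilon>: "agree x y \<epsilon>" "x \<epsilon> \<noteq> y \<epsilon>" by (rule first_difference)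
  have "\<alpha> \<le> \<epsilon>" using y(2) \<epsilon>(2) unfolding agree_def by (meson not_le)
  moreover have "\<epsilon> \<in> splits T x"
    using child_not_split[OF assms, of \<epsilon>] child_not_split[OF y(1), of \<epsilon>] \<epsilon>
      first_child_cong[OF \<epsilon>(1)] splits_cong[OF \<epsilon>(1)] by metis
  ultimately show ?thesis by blast
qed

lemma turns_at:
  assumes "\<delta> \<in> splits T x"
  shows "turns T x (otp (splits T x) \<delta>) = (if x \<delta> = first_child T x \<delta> then zero_ord else one_ord)"
proof -
  have "(THE \<delta>'. \<delta>' \<in> splits T x \<and> otp (splits T x) \<delta>' = otp (splits T x) \<delta>) = \<delta>"
    by (rule the_equality) (use assms otp_inj[OF hyp] in blast)+
  then show ?thesis unfolding turns_def by simp
qed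

lemma turns_at_agree:
  assumes "agree x y \<delta>" "\<delta> \<in> splits T x"
  shows "turns T y (otp (splits T x) \<delta>) = (if y \<delta> = first_child T x \<delta> then zero_ord else one_ord)"
  using turns_at[of \<delta> y] assms splits_cong[OF assms(1), of T] otp_splits_cong[OF assms(1), of T]
    first_child_cong[OF assms(1), of T]
  by simp

text \<open>
  Where two branches of the binary part first differ, both pass through the same splitting node and
  take different turns there.
\<close>

lemma agree_if_turns_agree:
  assumes x: "x \<in> branches (binary_part T)" and y: "y \<in> branches (binary_part T)"
    and a: "agree (turns T x) (turns T y) (otp (splits T x) \<delta>)"
  shows "agree x y \<delta>"
proof (rule ccontr)
  assume "\<not> agree x y \<delta>"
  then obtain \<epsilon> where \<epsilon>: "\<epsilon> < \<delta>" "agree x y \<epsilon>" "x \<epsilon> \<noteq> y \<epsilon>" by (rule first_difference)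
  have xT: "x \<in> branches T" "x \<epsilon> \<in> {first_child T x \<epsilon>, second_child T x \<epsilon>}"
    using x unfolding binary_branch_iff[OF hyp] by blast+
  have yT: "y \<in> branches T" "y \<epsilon> \<in> {first_child T x \<epsilon>, second_child T x \<epsilon>}"
    unfolding first_child_cong[OF \<epsilon>(2)] second_child_cong[OF \<epsilon>(2)]
    using y unfolding binary_branch_iff[OF hyp] by blast+
  have s: "\<epsilon> \<in> splits T x"
    using child_not_split[OF xT(1), of \<epsilon>] child_not_split[OF yT(1), of \<epsilon>] \<epsilon>
      first_child_cong[OF \<epsilon>(2)] splits_cong[OF \<epsilon>(2)] by metis
  then have "turns T x (otp (splits T x) \<epsilon>) = turns T y (otp (splits T x) \<epsilon>)"
    using a otp_less[OF hyp \<epsilon>(1) s] unfolding agree_def by blast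
  then show False
    using turns_at[OF s] turns_at_agree[OF \<epsilon>(2) s] xT(2) yT(2) \<epsilon>(3) zero_less_one_ord[OF hyp]
    by (auto split: if_splits)
qed

text \<open>
  The first \<open>\<rho>\<close> turns of \<open>x\<close> are taken at splitting nodes below the \<open>\<rho>\<close>-th one, and these are shared by
  all functions that agree with \<open>x\<close> up to there.
\<close>

lemma turns_agree_if_agree:
  assumes x: "x \<in> branches T"
  shows "\<exists>\<delta>. \<forall>y. agree x y \<delta> \<longrightarrow> agree (turns T x) (turns T y) \<rho>"
proof -
  obtain \<delta> where \<delta>: "\<delta> \<in> splits T x" "otp (splits T x) \<delta> = \<rho>"
    using otp_surj[OF hyp splits_unbounded[OF x]] by blast
  have "turns T x \<rho>' = turns T y \<rho>'" if y: "agree x y \<delta>" and "\<rho>' < \<rho>" for y \<rho>'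
  proof -
    obtain \<epsilon> where \<epsilon>: "\<epsilon> \<in> splits T x" "otp (splits T x) \<epsilon> = \<rho>'"
      using otp_surj[OF hyp splits_unbounded[OF x]] by blast
    have "\<epsilon> < \<delta>"
      using otp_less[OF hyp _ \<delta>(1), of \<epsilon>] \<epsilon> \<delta> \<open>\<rho>' < \<rho>\<close> by (cases \<epsilon> \<delta> rule: linorder_cases) auto
    then have "agree x y \<epsilon>" "x \<epsilon> = y \<epsilon>" using y agree_mono unfolding agree_def by (blast intro: less_trans)+
    then show ?thesis using turns_at[OF \<epsilon>(1)] turns_at_agree[OF _ \<epsilon>(1), of y] \<epsilon>(2) by simp
  qed
  then show ?thesis unfolding agree_def[of "turns T x"] by blast
qed

text \<open>
  Given the turns \<open>b\<close>, a branch follows them: at a splitting node, the number of splitting nodes passed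
  so far says which value of \<open>b\<close> to consult.
\<close>

lemma turns_surj:
  assumes b: "range b \<subseteq> {zero_ord, one_ord}" and ne: "T \<noteq> {}"
  obtains x where "x \<in> branches (binary_part T)" "turns T x = b"
proof -
  define g where "g x \<alpha> = (if \<alpha> \<in> splits T x \<and> b (otp (splits T x) \<alpha>) \<noteq> zero_ord
    then second_child T x \<alpha> else first_child T x \<alpha>)" for x \<alpha>
  have local: "g x \<alpha> = g y \<alpha>" if "agree x y \<alpha>" for x y \<alpha>
    unfolding g_def using first_child_cong[OF that, of T] second_child_cong[OF that, of T]
      splits_cong[OF that, of T] otp_splits_cong[OF that, of T] by simp
  have child: "g x \<alpha> \<in> children (binary_part T) x \<alpha>" if "initial_seg x \<alpha> \<in> binary_part T" for x \<alpha>
  proof (rule children_binary_part[OF hyp that])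
    have ch: "children T x \<alpha> \<noteq> {}" using superclosed_children[OF hyp T] that unfolding mem_binary_part by blast
    show "g x \<alpha> \<in> children T x \<alpha>"
      unfolding g_def using first_child_in[OF ch] second_child_in(1)[of \<alpha> T x] by simp
  qed (simp add: g_def)
  obtain s where "s \<in> T" using ne by blast
  then have "s |` {..<zero_ord} \<in> T" using T unfolding superclosed_tree_def tree_def by blast
  moreover have none: "\<not> \<alpha> < zero_ord" for \<alpha> :: 'k using zero_ord_le[of \<alpha>] by simp
  then have "{..<zero_ord :: 'k} = {}" by blast
  then have "s |` {..<zero_ord} = initial_seg b zero_ord" unfolding initial_seg_def restrict_map_def by simp
  ultimately have start: "initial_seg b zero_ord \<in> binary_part T" unfolding mem_binary_part using none by simp
  have B: "superclosed_tree (binary_part T)" using superclosed_binary_part[OF hyp T] .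
  obtain x where x: "x \<in> branches (binary_part T)" "\<And>\<alpha>. zero_ord \<le> \<alpha> \<Longrightarrow> x \<alpha> = g x \<alpha>"
    using branch_of_choice[of "binary_part T" g b zero_ord] B local child start unfolding superclosed_tree_def by metis
  have xT: "x \<in> branches T" using x(1) unfolding binary_branch_iff[OF hyp] by blast
  have "turns T x \<rho> = b \<rho>" for \<rho>
  proof -
    obtain \<delta> where \<delta>: "\<delta> \<in> splits T x" "otp (splits T x) \<delta> = \<rho>"
      using otp_surj[OF hyp splits_unbounded[OF xT]] by blast
    have "x \<delta> = g x \<delta>" using x(2)[OF zero_ord_le] .
    then have "x \<delta> = first_child T x \<delta> \<longleftrightarrow> b \<rho> = zero_ord"
      using second_child_in(2)[OF \<delta>(1)] \<delta> unfolding g_def by simp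
    moreover have "b \<rho> \<in> {zero_ord, one_ord}" using b by blast
    ultimately show ?thesis using turns_at[OF \<delta>(1)] \<delta>(2) by auto
  qed
  then show thesis using that x(1) by blast
qed

lemma turns_range: "range (turns T x) \<subseteq> {zero_ord, one_ord}"
  unfolding turns_def by (auto simp: Let_def)

text \<open>
  The two agreement lemmas above are continuity of \<open>turns T\<close> and of its inverse.
\<close>

lemma binary_part_homeomorphic_cantor_space:
  assumes ne: "T \<noteq> {}"
  shows "subtopology bounded_topology (branches (binary_part T)) homeomorphic_space
    (cantor_space :: ('k \<Rightarrow> 'k) topology)"
proof -
  let ?B = "branches (binary_part T)" and ?D = "{b :: 'k \<Rightarrow> 'k. range b \<subseteq> {zero_ord, one_ord}}"
  let ?X = "subtopology bounded_topology ?B" and ?Y = "subtopology bounded_topology ?D"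
  have BT: "x \<in> branches T" if "x \<in> ?B" for x using that unfolding binary_branch_iff[OF hyp] by blast
  have surj: "turns T ` ?B = ?D"
  proof
    show "?D \<subseteq> turns T ` ?B"
    proof
      fix b assume "b \<in> ?D"
      then obtain x where "x \<in> ?B" "turns T x = b" using turns_surj[OF _ ne, of b] by blast
      then show "b \<in> turns T ` ?B" by blast
    qed
  qed (use turns_range in blast)
  have cont: "continuous_map ?X ?Y (turns T)"
    unfolding continuous_map
  proof (intro conjI allI impI)
    fix U assume U: "openin ?Y U"
    have "\<exists>\<alpha>. \<forall>y\<in>?B. agree x y \<alpha> \<longrightarrow> turns T y \<in> U" if x: "x \<in> ?B" "turns T x \<in> U" for x
    proof -
      obtain \<rho> where \<rho>: "\<forall>c\<in>?D. agree (turns T x) c \<rho> \<longrightarrow> c \<in> U"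
        using U x(2) unfolding openin_subtopology_bounded by blast
      obtain \<delta> where "\<forall>y. agree x y \<delta> \<longrightarrow> agree (turns T x) (turns T y) \<rho>"
        using turns_agree_if_agree[OF BT[OF x(1)]] by blast
      then show ?thesis using \<rho> surj by blast
    qed
    then show "openin ?X {x \<in> topspace ?X. turns T x \<in> U}"
      unfolding openin_subtopology_bounded by simp
  qed (use surj in simp)
  have "open_map ?X ?Y (turns T)"
    unfolding open_map_def
  proof (intro allI impI)
    fix U assume "openin ?X U"
    then have U: "U \<subseteq> ?B" "\<And>x. x \<in> U \<Longrightarrow> \<exists>\<delta>. \<forall>y\<in>?B. agree x y \<delta> \<longrightarrow> y \<in> U"
      unfolding openin_subtopology_bounded by blast+
    have "\<exists>\<rho>. \<forall>c\<in>?D. agree (turns T x) c \<rho> \<longrightarrow> c \<in> turns T ` U" if x: "x \<in> U" for x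
    proof -
      obtain \<delta> where \<delta>: "\<forall>y\<in>?B. agree x y \<delta> \<longrightarrow> y \<in> U" using U(2)[OF x] by blast
      have "c \<in> turns T ` U" if c: "c \<in> ?D" "agree (turns T x) c (otp (splits T x) \<delta>)" for c
      proof -
        obtain y where y: "y \<in> ?B" "c = turns T y" using c(1) surj by blast
        then have "agree x y \<delta>" using agree_if_turns_agree[of x y \<delta>] c(2) U(1) x by blast
        then show ?thesis using \<delta> y by blast
      qed
      then show ?thesis by blast
    qed
    moreover have "turns T ` U \<subseteq> ?D" using U(1) surj by blast
    ultimately show "openin ?Y (turns T ` U)" unfolding openin_subtopology_bounded by simp
  qed
  moreover have "inj_on (turns T) ?B"
  proof (rule inj_onI)
    fix x y assume "x \<in> ?B" "y \<in> ?B" "turns T x = turns T y"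
    then show "x = y" using agree_if_turns_agree agree_refl agree_all_imp_eq[OF hyp] by metis
  qed
  ultimately have "homeomorphic_map ?X ?Y (turns T)"
    using bijective_open_imp_homeomorphic_map[OF cont] surj by simp
  then show ?thesis unfolding cantor_space_def by (rule homeomorphic_map_imp_homeomorphic_space)
qed

end

section \<open>Clopen bases\<close>

lemma additive_Inter:
  fixes U :: "'i \<Rightarrow> 'a set"
  assumes "kappa_additive TYPE('k::wellorder) X"
    and "|I| <o (kappa :: 'k rel)" and "\<And>i. i \<in> I \<Longrightarrow> openin X (U i)"
  shows "openin X (topspace X \<inter> (\<Inter>i\<in>I. U i))"
proof -
  have "|U ` I| <o (kappa :: 'k rel)" using card_of_image assms(2) ordLeq_ordLess_trans by blast
  then show ?thesis using assms(1,3) unfolding kappa_additive_def by blast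
qed

text \<open>
  Regularity gives open \<open>V n\<close> and closed \<open>K n\<close> with \<open>V (n + 1) \<subseteq> K n \<subseteq> V n\<close>. Their common intersection is
  closed, and open because \<open>\<kappa>\<close> is uncountable.
\<close>

lemma additive_regular_clopen:
  assumes hyp: "kappa_hyp TYPE('k::wellorder)" and add: "kappa_additive TYPE('k) X"
    and reg: "regular_space X" and U: "openin X U" "x \<in> U"
  shows "\<exists>C. openin X C \<and> closedin X C \<and> x \<in> C \<and> C \<subseteq> U"
proof -
  have shrink: "\<exists>V K. openin X V \<and> closedin X K \<and> x \<in> V \<and> V \<subseteq> K \<and> K \<subseteq> W" if "openin X W" "x \<in> W" for W
    using reg that unfolding neighbourhood_base_of_closedin[symmetric] neighbourhood_base_of by blast
  define P where "P n V \<longleftrightarrow> openin X V \<and> x \<in> V \<and> V \<subseteq> U" for n :: nat and V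
  define Q where "Q n W V \<longleftrightarrow> (\<exists>K. closedin X K \<and> V \<subseteq> K \<and> K \<subseteq> W)" for n :: nat and W V
  have "\<exists>V. \<forall>n. P n (V n) \<and> Q n (V n) (V (Suc n))"
  proof (rule dependent_nat_choice)
    show "\<exists>V. P 0 V" unfolding P_def using U by blast
  next
    fix W n assume "P n W"
    then have W: "openin X W" "x \<in> W" "W \<subseteq> U" unfolding P_def by auto
    obtain V K where "openin X V" "closedin X K" "x \<in> V" "V \<subseteq> K" "K \<subseteq> W" using shrink[OF W(1,2)] by blast
    then show "\<exists>V. P (Suc n) V \<and> Q n W V" unfolding P_def Q_def using W(3) by blast
  qed
  then obtain V where V: "\<And>n :: nat. P n (V n)" "\<And>n. Q n (V n) (V (Suc n))" by blast
  obtain K where K: "\<And>n. closedin X (K n)" "\<And>n. V (Suc n) \<subseteq> K n" "\<And>n. K n \<subseteq> V n"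
    using V(2) unfolding Q_def by metis
  define C where "C = (\<Inter>n. V n)"
  have sub: "C \<subseteq> topspace X" unfolding C_def using V(1) openin_subset unfolding P_def by blast
  have "openin X (topspace X \<inter> (\<Inter>n. V n))"
    by (rule additive_Inter[OF add card_countable[OF hyp]]) (use V(1) P_def in auto)
  then have "openin X C" using sub unfolding C_def[symmetric] by (simp add: Int_absorb1)
  moreover have "C = (\<Inter>n. K n)" unfolding C_def using K(2,3) by blast
  then have "closedin X C" using closedin_INT[of UNIV X K] K(1) by simp
  moreover have "x \<in> C" "C \<subseteq> U" using V(1) unfolding P_def C_def by blast+
  ultimately show ?thesis by blast
qed

text \<open>
  Choose one clopen set between any two members of the given base that admit one. There are at most
  \<open>\<kappa> \<cdot> \<kappa> = \<kappa>\<close> such pairs.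
\<close>

lemma clopen_base:
  assumes hyp: "kappa_hyp TYPE('k::wellorder)" and add: "kappa_additive TYPE('k) X"
    and reg: "regular_space X" and weight: "weight_le_kappa TYPE('k) X" and ne: "topspace X \<noteq> {}"
  obtains B :: "'k::wellorder \<Rightarrow> 'a set" where "\<And>i. openin X (B i)" "\<And>i. closedin X (B i)"
    "\<And>U x. openin X U \<Longrightarrow> x \<in> U \<Longrightarrow> \<exists>i. x \<in> B i \<and> B i \<subseteq> U"
proof -
  obtain \<B> where \<B>: "|\<B>| \<le>o (kappa :: 'k rel) \<and> (\<forall>V\<in>\<B>. openin X V) \<and>
      (\<forall>U x. openin X U \<and> x \<in> U \<longrightarrow> (\<exists>V\<in>\<B>. x \<in> V \<and> V \<subseteq> U))"
    using weight unfolding weight_le_kappa_def by (rule exE)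
  then have card: "|\<B>| \<le>o (kappa :: 'k rel)" and op: "\<And>V. V \<in> \<B> \<Longrightarrow> openin X V"
    and base: "\<And>U x. openin X U \<Longrightarrow> x \<in> U \<Longrightarrow> \<exists>V\<in>\<B>. x \<in> V \<and> V \<subseteq> U" by simp_all
  define between where "between p C \<longleftrightarrow> openin X C \<and> closedin X C \<and> fst p \<subseteq> C \<and> C \<subseteq> snd p" for p C
  define P where "P = {p\<in>\<B> \<times> \<B>. \<exists>C. between p C}"
  define c where "c p = (SOME C. between p C)" for p
  have c: "between p (c p)" if "p \<in> P" for p
    using someI_ex[of "between p"] that unfolding c_def P_def by blast
  have cbase: "\<exists>C\<in>c ` P. x \<in> C \<and> C \<subseteq> U" if U: "openin X U" "x \<in> U" for U x
  proof -
    obtain W where W: "W \<in> \<B>" "x \<in> W" "W \<subseteq> U" using base[OF U] by blast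
    obtain C where C: "openin X C" "closedin X C" "x \<in> C" "C \<subseteq> W"
      using additive_regular_clopen[OF hyp add reg op[OF W(1)] W(2)] by blast
    obtain V where V: "V \<in> \<B>" "x \<in> V" "V \<subseteq> C" using base[OF C(1,3)] by blast
    have "between (V, W) C" unfolding between_def using C V by simp
    then have p: "(V, W) \<in> P" using V W unfolding P_def by blast
    have "x \<in> c (V, W)" "c (V, W) \<subseteq> U" using c[OF p] V W unfolding between_def by auto
    then show ?thesis using p by blast
  qed
  have "|\<B> \<times> \<B>| \<le>o (kappa :: 'k rel)"
    using card_of_Times_ordLeq_infinite_Field[OF _ card card Card_order_kappa[OF hyp]]
      infinite_UNIV_kappa[OF hyp] unfolding Field_kappa by blast
  then have BB: "|\<B> \<times> \<B>| \<le>o |UNIV :: 'k set|"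
    by (rule ordLeq_ordIso_trans[OF _ ordIso_symmetric[OF card_of_UNIV_kappa[OF hyp]]])
  have "|P| \<le>o |\<B> \<times> \<B>|" by (rule card_of_mono1) (auto simp: P_def)
  from ordLeq_transitive[OF card_of_image ordLeq_transitive[OF this BB]]
  have cP: "|c ` P| \<le>o |UNIV :: 'k set|" .
  obtain x where "x \<in> topspace X" using ne by blast
  then have "c ` P \<noteq> {}" using cbase[of "topspace X" x] by blast
  from iffD2[OF card_of_ordLeq2[OF this] cP]
  obtain B :: "'k \<Rightarrow> 'a set" where B: "B ` UNIV = c ` P" by (rule exE)
  show thesis
  proof (rule that)
    have B_in: "B i \<in> c ` P" for i using B by blast
    have "openin X C \<and> closedin X C" if "C \<in> c ` P" for C using c that unfolding between_def by blast
    then show "openin X (B i)" "closedin X (B i)" for i using B_in by blast+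
    show "\<exists>i. x \<in> B i \<and> B i \<subseteq> U" if "openin X U" "x \<in> U" for U x
      using cbase[OF that] unfolding B[symmetric] by blast
  qed
qed

section \<open>A tree of clopen cells guided by the winning strategy\<close>

lemma response_cong:
  assumes "\<And>\<beta>. \<beta> \<le> \<alpha> \<Longrightarrow> M \<beta> = M' \<beta>" and "\<And>\<beta>. \<beta> < \<alpha> \<Longrightarrow> V \<beta> = V' \<beta>"
  shows "response \<sigma> M V \<alpha> = response \<sigma> M' V' \<alpha>"
proof -
  have "(Some \<circ> M) |` {..\<alpha>} = (Some \<circ> M') |` {..\<alpha>}" "(Some \<circ> V) |` {..<\<alpha>} = (Some \<circ> V') |` {..<\<alpha>}"
    using assms unfolding restrict_map_def by (auto simp: fun_eq_iff)
  then show ?thesis unfolding response_def by simp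
qed

lemma inter_before_cong:
  "(\<And>\<beta>. \<beta> < \<alpha> \<Longrightarrow> V \<beta> = V' \<beta>) \<Longrightarrow> inter_before X V \<alpha> = inter_before X V' \<alpha>"
  unfolding inter_before_def by auto

lemma good_round_cong:
  assumes "\<And>\<beta>. \<beta> \<le> \<alpha> \<Longrightarrow> M \<beta> = M' \<beta>" and "\<And>\<beta>. \<beta> \<le> \<alpha> \<Longrightarrow> V \<beta> = V' \<beta>"
  shows "good_round X \<sigma> M V \<alpha> = good_round X \<sigma> M' V' \<alpha>"
proof -
  have "response \<sigma> M V \<alpha> = response \<sigma> M' V' \<alpha>" using assms by (intro response_cong) simp_all
  moreover have "inter_before X V \<alpha> = inter_before X V' \<alpha>" using assms by (intro inter_before_cong) simp
  ultimately show ?thesis unfolding good_round_def legal_I_def using assms[of \<alpha>] by simp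
qed

type_synonym ('k, 'a) history = "'k \<Rightarrow> 'a \<Rightarrow> 'k \<times> ('a set \<times> 'a) \<times> 'a set"

text \<open>
  The recursion of this section runs over the level \<open>\<alpha>\<close>, for all points at once. At level \<open>\<alpha>\<close> a point \<open>y\<close> receives
  an index \<open>i\<close> of a basic set (its code at \<open>\<alpha>\<close>), a move of I and the reply of II. The cell of \<open>y\<close> at level \<open>\<alpha>\<close>
  consists of the points with the same codes below \<open>\<alpha>\<close>; working with points in place of nodes
  makes all cells nonempty and makes the tree of cells a by-product.
\<close>

locale choquet_scheme =
  fixes X :: "'a topology" and \<sigma> :: "('k::wellorder, 'a) strategy" and B :: "'k \<Rightarrow> 'a set"
  assumes hyp: "kappa_hyp TYPE('k)"
    and additive: "kappa_additive TYPE('k) X"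
    and winning: "winning_II X \<sigma>"
    and open_B: "\<And>i. openin X (B i)" and closed_B: "\<And>i. closedin X (B i)"
    and base_B: "\<And>U x. openin X U \<Longrightarrow> x \<in> U \<Longrightarrow> \<exists>i. x \<in> B i \<and> B i \<subseteq> U"
begin

definition cell :: "('k, 'a) history \<Rightarrow> 'a \<Rightarrow> 'k \<Rightarrow> 'a set" where
  "cell h y \<alpha> = {z\<in>topspace X. \<forall>\<beta><\<alpha>. fst (h \<beta> z) = fst (h \<beta> y)}"

text \<open>
  The answer of the strategy when, after the run recorded for \<open>y\<close>, player I moves \<open>(W, x)\<close> with \<open>W\<close> the cell of \<open>y\<close>.
\<close>

definition reply :: "('k, 'a) history \<Rightarrow> 'a \<Rightarrow> 'k \<Rightarrow> 'a \<Rightarrow> 'a set" where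
  "reply h y \<alpha> x =
     response \<sigma> ((\<lambda>\<beta>. fst (snd (h \<beta> y)))(\<alpha> := (cell h y \<alpha>, x))) (\<lambda>\<beta>. snd (snd (h \<beta> y))) \<alpha>"

text \<open>
  The last conjunct makes the pieces at level \<open>\<alpha>\<close> decide \<open>B \<alpha>\<close>; this is what turns the cells into a base.
\<close>

definition suitable ::
    "('k, 'a) history \<Rightarrow> 'a \<Rightarrow> 'k \<Rightarrow> 'k \<Rightarrow> 'a \<Rightarrow> bool" where
  "suitable h y \<alpha> i x \<longleftrightarrow> x \<in> cell h y \<alpha> \<and> B i \<inter> cell h y \<alpha> \<subseteq> reply h y \<alpha> x \<and>
     (B i \<subseteq> B \<alpha> \<or> B i \<inter> B \<alpha> = {})"

definition step ::
    "('k, 'a) history \<Rightarrow> ('k, 'a) history" where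
  "step h \<alpha> y =
     (let i = (LEAST i. y \<in> B i \<and> (\<exists>x. suitable h y \<alpha> i x)); x = (SOME x. suitable h y \<alpha> i x)
      in (i, (cell h y \<alpha>, x), reply h y \<alpha> x))"

text \<open>
  The recursion equation \<open>h \<alpha> = step h \<alpha>\<close> refers to \<open>h\<close> below \<open>\<alpha>\<close> only, although \<open>step\<close> takes all of \<open>h\<close> as its
  argument.
\<close>

definition stage :: "('k, 'a) history" where
  "stage = (SOME h. \<forall>\<alpha>. h \<alpha> = step h \<alpha>)"

definition code :: "'a \<Rightarrow> 'k \<Rightarrow> 'k" where
  "code y \<alpha> = fst (stage \<alpha> y)"

definition move_I :: "'a \<Rightarrow> 'k \<Rightarrow> 'a set \<times> 'a" where
  "move_I y \<alpha> = fst (snd (stage \<alpha> y))"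

definition move_II :: "'a \<Rightarrow> 'k \<Rightarrow> 'a set" where
  "move_II y \<alpha> = snd (snd (stage \<alpha> y))"

lemma reply_cong:
  assumes "\<And>\<beta>. \<beta> < \<alpha> \<Longrightarrow> h \<beta> y = h' \<beta> y'" and "cell h y \<alpha> = cell h' y' \<alpha>"
  shows "reply h y \<alpha> = reply h' y' \<alpha>"
  unfolding reply_def using assms by (intro ext response_cong) auto

lemma stage: "stage \<alpha> = step stage \<alpha>"
proof -
  have "step h \<alpha> = step h' \<alpha>" if "agree h h' \<alpha>" for h h' \<alpha>
  proof
    fix y
    have "cell h y \<alpha> = cell h' y \<alpha>" using that unfolding cell_def agree_def by simp
    moreover from this have "reply h y \<alpha> = reply h' y \<alpha>"
      using that unfolding agree_def by (intro reply_cong) auto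
    ultimately show "step h \<alpha> y = step h' \<alpha> y" unfolding step_def suitable_def by simp
  qed
  then obtain h where "\<And>\<alpha>. h \<alpha> = step h \<alpha>" using recursion_on_kappa[of step] by blast
  then have "\<exists>h. \<forall>\<alpha>. h \<alpha> = step h \<alpha>" by blast
  from someI_ex[OF this] show ?thesis unfolding stage_def[symmetric] by blast
qed

lemma cell_code: "cell stage y \<alpha> = {z\<in>topspace X. agree (code z) (code y) \<alpha>}"
  unfolding cell_def agree_def code_def by simp

lemma code_eq: "code y \<alpha> = (LEAST i. y \<in> B i \<and> (\<exists>x. suitable stage y \<alpha> i x))"
  unfolding code_def by (subst stage) (simp add: step_def Let_def)

lemma move_I_eq: "move_I y \<alpha> = (cell stage y \<alpha>, SOME x. suitable stage y \<alpha> (code y \<alpha>) x)"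
  unfolding move_I_def code_eq by (subst stage) (simp add: step_def Let_def)

lemma move_II_eq: "move_II y \<alpha> = reply stage y \<alpha> (snd (move_I y \<alpha>))"
proof -
  have "snd (snd (step stage \<alpha> y)) = reply stage y \<alpha> (snd (fst (snd (step stage \<alpha> y))))"
    by (simp add: step_def Let_def)
  then show ?thesis unfolding move_II_def move_I_def stage[symmetric] .
qed

lemma reply_eq: "reply stage y \<alpha> x = response \<sigma> ((move_I y)(\<alpha> := (cell stage y \<alpha>, x))) (move_II y) \<alpha>"
  unfolding reply_def move_I_def move_II_def ..

lemma cell_cong: "agree (code z) (code y) \<alpha> \<Longrightarrow> cell stage z \<alpha> = cell stage y \<alpha>"
  unfolding cell_code using agree_trans agree_sym by blast

text \<open>
  Points with the same codes share the whole run: cell, reply and the choice of the point played by I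
  are functions of the earlier stages and of the code alone.
\<close>

lemma stage_cong:
  assumes "agree (code z) (code y) \<alpha>" and "\<beta> < \<alpha>"
  shows "stage \<beta> z = stage \<beta> y"
  using assms(2)
proof (induction \<beta> rule: less_induct)
  case (less \<beta>)
  have c: "cell stage z \<beta> = cell stage y \<beta>"
    using cell_cong agree_mono[OF assms(1)] less.prems by simp
  have "stage \<gamma> z = stage \<gamma> y" if "\<gamma> < \<beta>" for \<gamma>
    using less.IH[OF that] less.prems that by simp
  then have r: "reply stage z \<beta> = reply stage y \<beta>" using c by (rule reply_cong)
  have s: "suitable stage z \<beta> = suitable stage y \<beta>" unfolding suitable_def c r ..
  have i: "code z \<beta> = code y \<beta>" using assms(1) less.prems unfolding agree_def by blast
  then have "move_I z \<beta> = move_I y \<beta>" unfolding move_I_eq s c by simp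
  moreover from this have "move_II z \<beta> = move_II y \<beta>" unfolding move_II_eq r by simp
  ultimately show ?case using i unfolding code_def move_I_def move_II_def by (simp add: prod_eq_iff)
qed

lemma suitable_cong:
  assumes "agree (code z) (code y) \<alpha>"
  shows "suitable stage z \<alpha> = suitable stage y \<alpha>"
  using reply_cong[OF stage_cong[OF assms] cell_cong[OF assms]] cell_cong[OF assms]
  unfolding suitable_def by simp

lemma self_in_cell: "y \<in> topspace X \<Longrightarrow> y \<in> cell stage y \<alpha>"
  unfolding cell_code by simp

definition proper_round :: "'a \<Rightarrow> 'k \<Rightarrow> bool" where
  "proper_round y \<alpha> \<longleftrightarrow> openin X (cell stage y \<alpha>) \<and> y \<in> B (code y \<alpha>) \<and>
     suitable stage y \<alpha> (code y \<alpha>) (snd (move_I y \<alpha>)) \<and>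
     good_round X \<sigma> (move_I y) (move_II y) \<alpha> \<and>
     openin X (move_II y \<alpha>) \<and> y \<in> move_II y \<alpha> \<and> move_II y \<alpha> \<subseteq> cell stage y \<alpha>"

text \<open>
  Within the cell, having code \<open>i\<close> means lying in \<open>B i\<close> and avoiding the fewer than \<open>\<kappa>\<close> many earlier clopen
  \<open>B j\<close> that are suitable.
\<close>

lemma openin_code_fibre:
  assumes y: "y \<in> topspace X" and proper: "\<And>z. z \<in> topspace X \<Longrightarrow> proper_round z \<beta>"
  shows "openin X {z\<in>cell stage y \<beta>. code z \<beta> = code y \<beta>}"
proof -
  define S where "S i \<longleftrightarrow> (\<exists>x. suitable stage y \<beta> i x)" for i
  define i where "i = code y \<beta>"
  define N where "N = topspace X \<inter> (\<Inter>j\<in>{..<i}. if S j then topspace X - B j else topspace X)"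
  have "openin X N" unfolding N_def
    by (rule additive_Inter[OF additive card_lessThan[OF hyp]]) (use closed_B in \<open>auto simp: closedin_def\<close>)
  moreover have "{z\<in>cell stage y \<beta>. code z \<beta> = i} = cell stage y \<beta> \<inter> B i \<inter> N"
  proof (intro set_eqI)
    fix z
    show "z \<in> {z\<in>cell stage y \<beta>. code z \<beta> = i} \<longleftrightarrow> z \<in> cell stage y \<beta> \<inter> B i \<inter> N"
    proof (cases "z \<in> cell stage y \<beta>")
      case True
      then have z: "z \<in> topspace X" "agree (code z) (code y) \<beta>" unfolding cell_code by auto
      have code: "code z \<beta> = (LEAST j. z \<in> B j \<and> S j)"
        unfolding code_eq S_def suitable_cong[OF z(2)] ..
      have Si: "S i" using proper[OF y] unfolding proper_round_def S_def i_def by blast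
      have N: "z \<in> N \<longleftrightarrow> (\<forall>j<i. S j \<longrightarrow> z \<notin> B j)" unfolding N_def using z(1) by auto
      have "code z \<beta> = i \<longleftrightarrow> z \<in> B i \<and> z \<in> N"
      proof
        assume "code z \<beta> = i"
        then have "z \<in> B i" using proper[OF z(1)] unfolding proper_round_def by blast
        moreover have "z \<notin> B j" if "j < i" "S j" for j
          using not_less_Least[of j "\<lambda>j. z \<in> B j \<and> S j"] that \<open>code z \<beta> = i\<close> unfolding code by blast
        ultimately show "z \<in> B i \<and> z \<in> N" unfolding N by blast
      next
        assume "z \<in> B i \<and> z \<in> N"
        then show "code z \<beta> = i" unfolding code N using Si by (intro Least_equality) (auto simp: not_less[symmetric])
      qed
      then show ?thesis using True by blast
    qed blast
  qed
  moreover have "openin X (cell stage y \<beta>)" using proper[OF y] unfolding proper_round_def by blast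
  ultimately show ?thesis unfolding i_def[symmetric] by (simp add: openin_Int open_B)
qed

text \<open>
  By induction the cell is an intersection of fewer than \<open>\<kappa>\<close> open fibres, hence open, and it
  is contained in all earlier replies; so \<open>(W, x)\<close> is a legal move for every \<open>x \<in> W\<close>, and the strategy
  answers it legally. The point \<open>y\<close> itself, as the choice of I, shows that a suitable basic set
  around \<open>y\<close> exists.
\<close>

lemma all_rounds_proper: "y \<in> topspace X \<Longrightarrow> proper_round y \<alpha>"
proof (induction \<alpha> arbitrary: y rule: less_induct)
  case (less \<alpha>)
  note y = \<open>y \<in> topspace X\<close>
  let ?W = "cell stage y \<alpha>" and ?M = "move_I y" and ?V = "move_II y"
  have "?W = topspace X \<inter> (\<Inter>\<beta>\<in>{..<\<alpha>}. {z\<in>cell stage y \<beta>. code z \<beta> = code y \<beta>})"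
    unfolding cell_code agree_def by (auto intro: less_trans)
  moreover have "openin X (topspace X \<inter> (\<Inter>\<beta>\<in>{..<\<alpha>}. {z\<in>cell stage y \<beta>. code z \<beta> = code y \<beta>}))"
    using openin_code_fibre[OF y less.IH] by (intro additive_Inter[OF additive card_lessThan[OF hyp]]) simp
  ultimately have openW: "openin X ?W" by simp
  have sub: "?W \<subseteq> inter_before X ?V \<alpha>"
  proof
    fix z assume "z \<in> ?W"
    then have z: "z \<in> topspace X" "agree (code z) (code y) \<alpha>" unfolding cell_code by auto
    have "z \<in> ?V \<beta>" if "\<beta> < \<alpha>" for \<beta>
    proof -
      have "z \<in> move_II z \<beta>" using less.IH[OF that z(1)] unfolding proper_round_def by blast
      then show ?thesis using stage_cong[OF z(2) that] unfolding move_II_def by simp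
    qed
    then show "z \<in> inter_before X ?V \<alpha>" unfolding inter_before_def using z(1) by blast
  qed
  have open_before: "openin X (inter_before X ?V \<alpha>)" unfolding inter_before_def
    by (rule additive_Inter[OF additive card_lessThan[OF hyp]]) (use less.IH[OF _ y] in \<open>auto simp: proper_round_def\<close>)
  have legalI: "legal_I X ?V \<alpha> (?W, x)" if "x \<in> ?W" for x
    unfolding legal_I_def using openW sub that open_before by (simp add: openin_open_subtopology)
  have rep: "openin X (reply stage y \<alpha> x) \<and> x \<in> reply stage y \<alpha> x \<and> reply stage y \<alpha> x \<subseteq> ?W"
    if x: "x \<in> ?W" for x
  proof -
    let ?M' = "?M(\<alpha> := (?W, x))"
    have "good_round X \<sigma> ?M' ?V \<beta>" if "\<beta> < \<alpha>" for \<beta>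
    proof -
      have "good_round X \<sigma> ?M ?V \<beta>" using less.IH[OF that y] unfolding proper_round_def by blast
      moreover have "good_round X \<sigma> ?M ?V \<beta> = good_round X \<sigma> ?M' ?V \<beta>"
        using that by (intro good_round_cong) auto
      ultimately show ?thesis by simp
    qed
    moreover have "legal_I X ?V \<alpha> (?M' \<alpha>)" using legalI[OF x] by simp
    ultimately have "legal_II X ?V \<alpha> (?M' \<alpha>) (response \<sigma> ?M' ?V \<alpha>)"
      using winning unfolding winning_II_def by blast
    then show ?thesis unfolding reply_eq legal_II_def using open_before by (simp add: openin_open_subtopology)
  qed
  have yW: "y \<in> ?W" using self_in_cell[OF y] .
  \<comment> \<open>A neighbourhood of \<open>y\<close> that lies in the reply and decides \<open>B \<alpha>\<close>.\<close>
  define U where "U = reply stage y \<alpha> y \<inter> (if y \<in> B \<alpha> then B \<alpha> else topspace X - B \<alpha>)"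
  have "openin X U" "y \<in> U" unfolding U_def using rep[OF yW] open_B closed_B y by (auto simp: closedin_def)
  then obtain i where i: "y \<in> B i" "B i \<subseteq> U" using base_B by blast
  have "suitable stage y \<alpha> i y"
    unfolding suitable_def using yW i(2) unfolding U_def by (auto split: if_splits)
  then have "\<exists>i. y \<in> B i \<and> (\<exists>x. suitable stage y \<alpha> i x)" using i(1) by blast
  from LeastI_ex[OF this] have c: "y \<in> B (code y \<alpha>)" "\<exists>x. suitable stage y \<alpha> (code y \<alpha>) x"
    unfolding code_eq by blast+
  have M: "?M \<alpha> = (?W, snd (?M \<alpha>))" unfolding move_I_eq by simp
  have s: "suitable stage y \<alpha> (code y \<alpha>) (snd (?M \<alpha>))"
    using someI_ex[OF c(2)] unfolding move_I_eq by simp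
  then have x: "snd (?M \<alpha>) \<in> ?W" and "B (code y \<alpha>) \<inter> ?W \<subseteq> reply stage y \<alpha> (snd (?M \<alpha>))"
    unfolding suitable_def by auto
  then have "y \<in> ?V \<alpha>" unfolding move_II_eq using c(1) yW by blast
  moreover have "good_round X \<sigma> ?M ?V \<alpha>"
    unfolding good_round_def
  proof
    show "legal_I X ?V \<alpha> (?M \<alpha>)" using legalI[OF x] M by simp
    have "?M(\<alpha> := (?W, snd (?M \<alpha>))) = ?M" using M by (metis fun_upd_triv)
    then show "?V \<alpha> = response \<sigma> ?M ?V \<alpha>" using move_II_eq[of y \<alpha>] reply_eq[of y \<alpha> "snd (?M \<alpha>)"] by simp
  qed
  ultimately show ?case
    using openW c(1) s rep[OF x] unfolding proper_round_def move_II_eq[of y \<alpha>] by blast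
qed

lemma code_decides:
  assumes "y \<in> topspace X" "z \<in> topspace X" "code y \<alpha> = code z \<alpha>" "y \<in> B \<alpha>"
  shows "z \<in> B \<alpha>"
  using all_rounds_proper[OF assms(1), of \<alpha>] all_rounds_proper[OF assms(2), of \<alpha>] assms(3,4)
  unfolding proper_round_def suitable_def by auto

text \<open>
  The index set \<open>A\<close> is \<open>\<kappa>\<close> or a limit \<open>\<gamma> < \<kappa>\<close>. Each \<open>\<beta> \<in> A\<close> has a point \<open>q \<beta>\<close> with codes \<open>b\<close> up to and including \<open>\<beta>\<close>.
  The runs of the \<open>q \<beta>\<close> cohere to one run of length \<open>A\<close>, and a point \<open>z\<close> in all replies of that run lies
  in all the cells, since every reply is contained in the cell that I has played.
\<close>

lemma code_realized:
  assumes A: "\<And>\<beta> \<gamma>. \<beta> \<in> A \<Longrightarrow> \<gamma> \<le> \<beta> \<Longrightarrow> \<gamma> \<in> A" "\<And>\<beta>. \<beta> \<in> A \<Longrightarrow> \<exists>\<beta>'\<in>A. \<beta> < \<beta>'"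
    and b: "\<And>\<alpha>. \<alpha> \<in> A \<Longrightarrow> \<exists>y\<in>topspace X. agree b (code y) \<alpha>"
    and ne: "\<And>M V. (\<And>\<beta>. \<beta> \<in> A \<Longrightarrow> good_round X \<sigma> M V \<beta>) \<Longrightarrow> topspace X \<inter> (\<Inter>\<beta>\<in>A. V \<beta>) \<noteq> {}"
  shows "\<exists>z\<in>topspace X. \<forall>\<beta>\<in>A. b \<beta> = code z \<beta>"
proof -
  have "\<exists>y\<in>topspace X. \<forall>\<gamma>\<le>\<beta>. b \<gamma> = code y \<gamma>" if "\<beta> \<in> A" for \<beta>
  proof -
    obtain \<beta>' where "\<beta>' \<in> A" "\<beta> < \<beta>'" using A(2)[OF \<open>\<beta> \<in> A\<close>] by blast
    obtain y where "y \<in> topspace X" "agree b (code y) \<beta>'" using b[OF \<open>\<beta>' \<in> A\<close>] by blast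
    then show ?thesis using le_less_trans[OF _ \<open>\<beta> < \<beta>'\<close>] unfolding agree_def by blast
  qed
  then have "\<forall>\<beta>\<in>A. \<exists>y. y \<in> topspace X \<and> (\<forall>\<gamma>\<le>\<beta>. b \<gamma> = code y \<gamma>)" by blast
  from bchoice[OF this] obtain q where
    "\<forall>\<beta>\<in>A. q \<beta> \<in> topspace X \<and> (\<forall>\<gamma>\<le>\<beta>. b \<gamma> = code (q \<beta>) \<gamma>)" by (rule exE)
  then have q: "\<And>\<beta>. \<beta> \<in> A \<Longrightarrow> q \<beta> \<in> topspace X"
    "\<And>\<beta> \<gamma>. \<beta> \<in> A \<Longrightarrow> \<gamma> \<le> \<beta> \<Longrightarrow> b \<gamma> = code (q \<beta>) \<gamma>" by simp_all
  define M where "M \<beta> = move_I (q \<beta>) \<beta>" for \<beta>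
  define V where "V \<beta> = move_II (q \<beta>) \<beta>" for \<beta>
  have "good_round X \<sigma> M V \<beta>" if "\<beta> \<in> A" for \<beta>
  proof -
    obtain \<beta>' where \<beta>': "\<beta>' \<in> A" "\<beta> < \<beta>'" using A(2)[OF \<open>\<beta> \<in> A\<close>] by blast
    \<comment> \<open>Coherence: \<open>q \<gamma>\<close> and \<open>q \<beta>\<close> have the same codes up to \<open>\<gamma>\<close>, hence the same round \<open>\<gamma>\<close>.\<close>
    have same: "stage \<gamma> (q \<gamma>) = stage \<gamma> (q \<beta>)" if "\<gamma> \<le> \<beta>" for \<gamma>
    proof -
      have gA: "\<gamma> \<in> A" using A(1)[OF \<open>\<beta> \<in> A\<close> that] .
      obtain \<gamma>' where \<gamma>': "{..<\<gamma>'} = {..\<gamma>}" using ex_successor[OF hyp] by blast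
      have lt: "\<delta> < \<gamma>' \<longleftrightarrow> \<delta> \<le> \<gamma>" for \<delta> unfolding lessThan_iff[symmetric] \<gamma>' by simp
      have "agree (code (q \<gamma>)) (code (q \<beta>)) \<gamma>'"
        unfolding agree_def lt using q(2)[OF gA] q(2)[OF \<open>\<beta> \<in> A\<close>] that by (metis order.trans)
      then show ?thesis using stage_cong lt by blast
    qed
    have "good_round X \<sigma> (move_I (q \<beta>)) (move_II (q \<beta>)) \<beta>"
      using all_rounds_proper[OF q(1)[OF that]] unfolding proper_round_def by blast
    moreover have "good_round X \<sigma> M V \<beta> = good_round X \<sigma> (move_I (q \<beta>)) (move_II (q \<beta>)) \<beta>"
      by (rule good_round_cong) (simp_all add: M_def V_def move_I_def move_II_def same)
    ultimately show ?thesis by simp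
  qed
  then obtain z where z: "z \<in> topspace X" "\<And>\<beta>. \<beta> \<in> A \<Longrightarrow> z \<in> V \<beta>" using ne[of M V] by blast
  have "b \<beta> = code z \<beta>" if "\<beta> \<in> A" for \<beta>
  proof -
    obtain \<beta>' where \<beta>': "\<beta>' \<in> A" "\<beta> < \<beta>'" using A(2)[OF \<open>\<beta> \<in> A\<close>] by blast
    have "z \<in> cell stage (q \<beta>') \<beta>'"
      using z(2)[OF \<beta>'(1)] all_rounds_proper[OF q(1)[OF \<beta>'(1)], of \<beta>'] unfolding V_def proper_round_def by blast
    then have "code z \<beta> = code (q \<beta>') \<beta>" using \<beta>'(2) unfolding cell_code agree_def by blast
    then show ?thesis using q(2)[OF \<beta>'(1), of \<beta>] \<beta>'(2) by simp
  qed
  then show ?thesis using z(1) by blast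
qed

definition code_tree :: "('k \<rightharpoonup> 'k) set" where
  "code_tree = {initial_seg (code y) \<alpha> | y \<alpha>. y \<in> topspace X}"

lemma mem_code_tree: "initial_seg b \<alpha> \<in> code_tree \<longleftrightarrow> (\<exists>y\<in>topspace X. agree b (code y) \<alpha>)"
proof
  assume "initial_seg b \<alpha> \<in> code_tree"
  then obtain y \<beta> where y: "y \<in> topspace X" "initial_seg b \<alpha> = initial_seg (code y) \<beta>"
    unfolding code_tree_def by blast
  then have "\<alpha> = \<beta>" by (intro initial_seg_eq_length)
  then show "\<exists>y\<in>topspace X. agree b (code y) \<alpha>" using y initial_seg_eq_iff by blast
next
  assume "\<exists>y\<in>topspace X. agree b (code y) \<alpha>"
  then show "initial_seg b \<alpha> \<in> code_tree" unfolding code_tree_def initial_seg_eq_iff[symmetric] by blast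
qed

text \<open>
  Every branch is the code of a point because II wins the full run of length \<open>\<kappa>\<close>.
\<close>

lemma branches_code_tree: "branches code_tree = code ` topspace X"
proof (intro set_eqI iffI)
  fix b assume b: "b \<in> branches code_tree"
  have "\<exists>z\<in>topspace X. \<forall>\<beta>\<in>UNIV. b \<beta> = code z \<beta>"
  proof (rule code_realized)
    show "\<exists>\<beta>'\<in>UNIV. \<beta> < \<beta>'" for \<beta> :: 'k using ex_greater[OF hyp] by blast
    show "\<exists>y\<in>topspace X. agree b (code y) \<alpha>" for \<alpha>
      using branch_node[OF b, of \<alpha>] unfolding mem_code_tree .
    show "topspace X \<inter> (\<Inter>\<beta>\<in>UNIV. V \<beta>) \<noteq> {}" if "\<And>\<beta>. \<beta> \<in> UNIV \<Longrightarrow> good_round X \<sigma> M V \<beta>" for M V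
      using winning that unfolding winning_II_def by blast
  qed blast
  then obtain z where "z \<in> topspace X" "\<And>\<beta>. b \<beta> = code z \<beta>" by blast
  then have "b = code z" by blast
  then show "b \<in> code ` topspace X" using \<open>z \<in> topspace X\<close> by blast
next
  fix b assume "b \<in> code ` topspace X"
  then show "b \<in> branches code_tree" unfolding branches_def mem_Collect_eq mem_code_tree using agree_refl by blast
qed

text \<open>
  \<open><\<kappa>\<close>-closure is the winning condition of II at limits below \<open>\<kappa>\<close>.
\<close>

lemma superclosed_code_tree: "superclosed_tree code_tree"
proof (rule superclosed_treeI)
  show "tree code_tree"
    unfolding tree_def
  proof (intro conjI ballI allI)
    show "code_tree \<subseteq> seqs_below UNIV" unfolding code_tree_def using initial_seg_mem_seqs by blast
  next
    fix s \<beta> assume "s \<in> code_tree"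
    then obtain y \<alpha> where y: "y \<in> topspace X" "s = initial_seg (code y) \<alpha>" unfolding code_tree_def by blast
    show "s |` {..<\<beta>} \<in> code_tree"
    proof (cases "\<beta> \<le> \<alpha>")
      case True
      show ?thesis unfolding y(2) initial_seg_restrict[OF True] mem_code_tree using y(1) agree_refl by blast
    next
      case False
      then have "dom s \<subseteq> {..<\<beta>}" unfolding y(2) dom_initial_seg by auto
      then show ?thesis using \<open>s \<in> code_tree\<close> restrict_map_id by metis
    qed
  qed
  show "lt_kappa_closed code_tree"
    unfolding lt_kappa_closed_def
  proof (intro allI impI)
    fix \<gamma> and s :: "'k \<rightharpoonup> 'k"
    assume "limit_ord \<gamma> \<and> dom s = {..<\<gamma>} \<and> (\<forall>\<alpha><\<gamma>. s |` {..<\<alpha>} \<in> code_tree)"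
    then have lim: "limit_ord \<gamma>" and dom: "dom s = {..<\<gamma>}"
      and sub: "\<And>\<alpha>. \<alpha> < \<gamma> \<Longrightarrow> s |` {..<\<alpha>} \<in> code_tree" by iprover+
    define b where "b = the \<circ> s"
    have s: "s = initial_seg b \<gamma>" unfolding b_def using initial_seg_the_self[OF dom] by (rule sym)
    have "\<exists>z\<in>topspace X. \<forall>\<beta>\<in>{..<\<gamma>}. b \<beta> = code z \<beta>"
    proof (rule code_realized)
      show "\<exists>\<beta>'\<in>{..<\<gamma>}. \<beta> < \<beta>'" if "\<beta> \<in> {..<\<gamma>}" for \<beta>
        using lim that unfolding limit_ord_def lessThan_iff by blast
      show "\<exists>y\<in>topspace X. agree b (code y) \<alpha>" if "\<alpha> \<in> {..<\<gamma>}" for \<alpha>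
      proof -
        have "\<alpha> < \<gamma>" using that by simp
        from sub[OF this] show ?thesis
          unfolding s initial_seg_restrict[OF less_imp_le[OF \<open>\<alpha> < \<gamma>\<close>]] mem_code_tree .
      qed
      show "topspace X \<inter> (\<Inter>\<beta>\<in>{..<\<gamma>}. V \<beta>) \<noteq> {}"
        if "\<And>\<beta>. \<beta> \<in> {..<\<gamma>} \<Longrightarrow> good_round X \<sigma> M V \<beta>" for M V
        using winning that lim unfolding winning_II_def inter_before_def lessThan_iff by blast
    qed auto
    then show "s \<in> code_tree" unfolding s mem_code_tree agree_def by blast
  qed
  fix b \<alpha> assume "initial_seg b \<alpha> \<in> code_tree"
  then obtain y where y: "y \<in> topspace X" "agree b (code y) \<alpha>" unfolding mem_code_tree by blast
  then have "code y \<in> branches code_tree" unfolding branches_code_tree by blast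
  then show "children code_tree b \<alpha> \<noteq> {}"
    using branch_child[OF hyp] children_cong[OF y(2)] by blast
qed

text \<open>
  Cells are open, which gives continuity. The code at \<open>\<alpha>\<close> decides membership in \<open>B \<alpha>\<close>, and the sets \<open>B \<alpha>\<close> form a
  base; this gives openness, and injectivity for Hausdorff \<open>X\<close>.
\<close>

lemma superclosed_presentation_code:
  assumes "Hausdorff_space X"
  shows "superclosed_presentation X code"
proof -
  let ?Y = "subtopology bounded_topology (code ` topspace X)"
  have cont: "continuous_map X ?Y code"
    unfolding continuous_map
  proof (intro conjI allI impI)
    fix U assume U: "openin ?Y U"
    show "openin X {y \<in> topspace X. code y \<in> U}"
      unfolding openin_subopen[of X "{y \<in> topspace X. code y \<in> U}"]
    proof
      fix y assume "y \<in> {y \<in> topspace X. code y \<in> U}"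
      then have y: "y \<in> topspace X" "code y \<in> U" by auto
      obtain \<alpha> where \<alpha>: "\<forall>c\<in>code ` topspace X. agree (code y) c \<alpha> \<longrightarrow> c \<in> U"
        using U y(2) unfolding openin_subtopology_bounded by blast
      have "openin X (cell stage y \<alpha>)" using all_rounds_proper[OF y(1)] unfolding proper_round_def by blast
      moreover have "cell stage y \<alpha> \<subseteq> {y \<in> topspace X. code y \<in> U}"
        unfolding cell_code using \<alpha> agree_sym by blast
      ultimately show "\<exists>W. openin X W \<and> y \<in> W \<and> W \<subseteq> {y \<in> topspace X. code y \<in> U}"
        using self_in_cell[OF y(1)] by blast
    qed
  qed simp
  have "open_map X ?Y code"
    unfolding open_map_def
  proof (intro allI impI)
    fix U assume U: "openin X U"
    then have UX: "U \<subseteq> topspace X" by (rule openin_subset)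
    have "\<exists>\<alpha>. \<forall>c\<in>code ` topspace X. agree (code y) c \<alpha> \<longrightarrow> c \<in> code ` U" if y: "y \<in> U" for y
    proof -
      obtain \<alpha> where \<alpha>: "y \<in> B \<alpha>" "B \<alpha> \<subseteq> U" using base_B[OF U y] by blast
      obtain \<alpha>' where \<alpha>': "\<alpha> < \<alpha>'" using ex_greater[OF hyp] by blast
      have "z \<in> U" if "z \<in> topspace X" "agree (code y) (code z) \<alpha>'" for z
        using code_decides[of y z \<alpha>] that \<alpha> \<alpha>' UX y unfolding agree_def by blast
      then show ?thesis by blast
    qed
    then show "openin ?Y (code ` U)" unfolding openin_subtopology_bounded using UX by blast
  qed
  moreover have "inj_on code (topspace X)"
  proof (rule inj_onI, rule ccontr)
    fix y z assume yz: "y \<in> topspace X" "z \<in> topspace X" "code y = code z" "y \<noteq> z"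
    then obtain U where U: "openin X U" "y \<in> U" "z \<notin> U"
      using assms unfolding Hausdorff_space_def disjnt_def by blast
    then obtain \<alpha> where "y \<in> B \<alpha>" "B \<alpha> \<subseteq> U" using base_B by blast
    then show False using code_decides[OF yz(1,2)] yz(3) U(3) by auto
  qed
  ultimately have "homeomorphic_map X ?Y code"
    using bijective_open_imp_homeomorphic_map[OF cont] by simp
  then show ?thesis
    unfolding superclosed_presentation_def
    using superclosed_branches[OF superclosed_code_tree] unfolding branches_code_tree by blast
qed

end

section \<open>Cantor subspaces of perfect superclosed presentations\<close>

lemma perfect_if_kappa_perfect:
  assumes "kappa_hyp TYPE('k::wellorder)" and "kappa_perfect_space TYPE('k) X"
  shows "perfect_space X"
  unfolding perfect_space_def
proof (intro ballI notI)
  fix x assume x: "x \<in> topspace X" "openin X {x}"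
  have "|{{x}}| <o (kappa :: 'k rel)" by (rule card_countable[OF assms(1)]) simp
  moreover have "{x} = topspace X \<inter> \<Inter>{{x}}" using x(1) by simp
  ultimately have "\<exists>\<U>. (\<forall>U\<in>\<U>. openin X U) \<and> |\<U>| <o (kappa :: 'k rel) \<and> {x} = topspace X \<inter> \<Inter>\<U>"
    using x(2) by (intro exI[of _ "{{x}}"]) simp
  then show False using assms(2) x(1) unfolding kappa_perfect_space_def by blast
qed

lemma presentation_exists:
  fixes X :: "'a topology"
  assumes hyp: "kappa_hyp TYPE('k::wellorder)"
    and "Hausdorff_space X" and "regular_space X" and "topspace X \<noteq> {}"
    and add: "kappa_additive TYPE('k) X" and SC: "SC_space TYPE('k) X"
  shows "\<exists>f :: 'a \<Rightarrow> 'k \<Rightarrow> 'k. superclosed_presentation X f"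
proof -
  obtain \<sigma> :: "('k, 'a) strategy" where weight: "weight_le_kappa TYPE('k) X" and \<sigma>: "winning_II X \<sigma>"
    using SC unfolding SC_space_def by blast
  obtain B :: "'k \<Rightarrow> 'a set" where B: "\<And>i. openin X (B i)" "\<And>i. closedin X (B i)"
    "\<And>U x. openin X U \<Longrightarrow> x \<in> U \<Longrightarrow> \<exists>i. x \<in> B i \<and> B i \<subseteq> U"
    by (rule clopen_base[OF hyp add assms(3) weight assms(4)], rule that)
  interpret choquet_scheme X \<sigma> B
    by (rule choquet_scheme.intro[OF hyp add \<sigma> B])
  show ?thesis using superclosed_presentation_code[OF assms(2)] by blast
qed

text \<open>
  An isolated branch of \<open>T\<close> would be an isolated point of \<open>X\<close>; so the thinning applies to \<open>T\<close>, and
  the preimage of the thinned set is as required.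
\<close>

lemma presentation_contains_cantor_space:
  fixes X :: "'a topology" and f :: "'a \<Rightarrow> 'k::wellorder \<Rightarrow> 'k"
  assumes hyp: "kappa_hyp TYPE('k)" and ne: "topspace X \<noteq> {}" and perfect: "perfect_space X"
    and f: "superclosed_presentation X f"
  shows "\<exists>C \<subseteq> topspace X. superclosed (f ` C) \<and>
    subtopology X C homeomorphic_space (cantor_space :: ('k \<Rightarrow> 'k) topology)"
proof -
  let ?Y = "subtopology bounded_topology (f ` topspace X)"
  obtain T where T: "superclosed_tree T" and fX: "f ` topspace X = branches T"
    and hom: "homeomorphic_map X ?Y f"
    using f unfolding superclosed_presentation_def superclosed_def by blast
  have split: "\<exists>y\<in>branches T. agree x y \<alpha> \<and> y \<noteq> x" if x: "x \<in> branches T" for x \<alpha>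
  proof (rule ccontr)
    assume isolated: "\<not> (\<exists>y\<in>branches T. agree x y \<alpha> \<and> y \<noteq> x)"
    obtain a where a: "a \<in> topspace X" "x = f a" using x fX by blast
    have "\<exists>\<alpha>. \<forall>y\<in>f ` topspace X. agree x y \<alpha> \<longrightarrow> y \<in> {x}" using isolated unfolding fX by blast
    then have "openin ?Y (f ` {a})" unfolding openin_subtopology_bounded using a by simp
    then have "openin X {a}" using homeomorphic_map_openness[OF hom, of "{a}"] a(1) by simp
    then show False using perfect a(1) unfolding perfect_space_def by blast
  qed
  let ?B = "branches (binary_part T)"
  define C where "C = {a\<in>topspace X. f a \<in> ?B}"
  have "?B \<subseteq> f ` topspace X" unfolding fX using binary_branch_iff[OF hyp] by blast
  then have fC: "f ` C = ?B" unfolding C_def by blast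
  have "f ` (topspace X \<inter> C) = topspace ?Y \<inter> ?B"
    using fC \<open>?B \<subseteq> f ` topspace X\<close> unfolding C_def by auto
  from homeomorphic_map_imp_homeomorphic_space[OF homeomorphic_map_subtopologies[OF hom this]]
  have "subtopology X C homeomorphic_space subtopology bounded_topology ?B"
    using \<open>?B \<subseteq> f ` topspace X\<close> by (simp add: subtopology_subtopology Int_absorb1)
  also have "subtopology bounded_topology ?B homeomorphic_space (cantor_space :: ('k \<Rightarrow> 'k) topology)"
  proof (rule binary_part_homeomorphic_cantor_space[OF hyp T split])
    have "branches T \<noteq> {}" using ne unfolding fX[symmetric] by simp
    then show "T \<noteq> {}" unfolding branches_def by blast
  qed
  finally have "subtopology X C homeomorphic_space (cantor_space :: ('k \<Rightarrow> 'k) topology)" .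
  moreover have "superclosed (f ` C)"
    unfolding fC by (rule superclosed_branches[OF superclosed_binary_part[OF hyp T]])
  moreover have "C \<subseteq> topspace X" unfolding C_def by blast
  ultimately show ?thesis by blast
qed

theorem theorem3p6:
  fixes X :: "'a topology"
  assumes "kappa_hyp TYPE('k::wellorder)"
    and "Hausdorff_space X" and "regular_space X" and "topspace X \<noteq> {}"
    and "kappa_additive TYPE('k) X"
    and "SC_space TYPE('k) X"
    and "perfect_space X \<or> kappa_perfect_space TYPE('k) X"
  shows "(\<exists>f :: 'a \<Rightarrow> 'k \<Rightarrow> 'k. superclosed_presentation X f) \<and>
    (\<forall>f :: 'a \<Rightarrow> 'k \<Rightarrow> 'k. superclosed_presentation X f \<longrightarrow>
      (\<exists>C \<subseteq> topspace X. superclosed (f ` C) \<and>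
         subtopology X C homeomorphic_space (cantor_space :: ('k \<Rightarrow> 'k) topology)))"
proof (intro conjI allI impI)
  show "\<exists>f :: 'a \<Rightarrow> 'k \<Rightarrow> 'k. superclosed_presentation X f"
    using presentation_exists[OF assms(1-6)] .
next
  fix f :: "'a \<Rightarrow> 'k \<Rightarrow> 'k" assume f: "superclosed_presentation X f"
  have "perfect_space X" using assms(7) perfect_if_kappa_perfect[OF assms(1)] by blast
  then show "\<exists>C \<subseteq> topspace X. superclosed (f ` C) \<and>
      subtopology X C homeomorphic_space (cantor_space :: ('k \<Rightarrow> 'k) topology)"
    using presentation_contains_cantor_space[OF assms(1,4) _ f] by blast
qed

end
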